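(* The scaling algorithm without operational constraints, started at an allocation $(\vec{\bar d},\vec{\bar b})$ with $c(\vec{\bar d},\vec{\bar b})<\infty$, finds an optimal solution of $$\min\ c(\vec d,\vec b)\quad\text{s.t.}\quad \sum_i (d_i+b_i)=D+B,\quad \sum_i b_i=B,\qquad (\vec d,\vec b)\in\mathbb Z^n\times\mathbb Z^n,$$ in $O(n\log(B+D))$ iterations.
   Context: **Costs.** Stations are indexed by $[n]=\{1,\dots,n\}$; $D,B$ are nonnegative integers, $B+D\ge1$. For a finite sequence $X=(X_1,\dots,X_s)\in\{\pm1\}^s$ ($X_t=1$: attempted bike return, $X_t=-1$: attempted rental) and integers $d,b\ge 0$ let $\delta_0=d$, $\delta_t=\max\{0,\min\{d+b,\delta_{t-1}-X_t\}\}$ and $$c^X(d,b)=|\{t:X_t=1,\ \delta_{t-1}=0\}|+|\{t:X_t=-1,\ \delta_{t-1}=d+b\}|.$$ Each station $i$ has a probability distribution $p_i$ on finite $\pm1$ sequences and integers $0\le l_i\le u_i$, and $c_i(d,b)=\mathbb E_{X\sim p_i}[c^X(d,b)]$ if $d,b\ge0$ and $l_i\le d+b\le u_i$, while $c_i(d,b)=\infty$ for all other $(d,b)\in\mathbb Z^2$. (One station may be a "depot" station, for which instead $c_i(d,b)=d+b-l_i$ on the same kind of domain and $\infty$ elsewhere.) The objective is $c(\vec d,\vec b)=\sum_i c_i(d_i,b_i)$. **Allocations.** An allocation is a pair $(\vec d,\vec b)\in\mathbb Z^n\times\mathbb Z^n$ with $\sum_i(d_i+b_i)=D+B$ and $\sum_i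 b_i=B$. **Scaled dock-moves.** With unit vectors $e_i$, for a positive integer $\alpha$, stations $i\ne j$ and a station $h$: $o^\alpha_{ij}(\vec d,\vec b)=(\vec d-\alpha e_i+\alpha e_j,\vec b)$; $e^\alpha_{ij}(\vec d,\vec b)=(\vec d,\vec b-\alpha e_i+\alpha e_j)$; $E^\alpha_{ijh}(\vec d,\vec b)=(\vec d-\alpha e_i+\alpha e_h,\vec b+\alpha e_j-\alpha e_h)$; $O^\alpha_{ijh}(\vec d,\vec b)=(\vec d+\alpha e_j-\alpha e_h,\vec b-\alpha e_i+\alpha e_h)$. $N^\alpha(\vec d,\vec b)$ is the set of all allocations obtained from $(\vec d,\vec b)$ by one such transformation. **Scaling algorithm without operational constraints.** Start with $(\vec d,\vec b)=(\vec{\bar d},\vec{\bar b})$. For $k=0,1,\dots,\lfloor\log_2(B+D)\rfloor+1$ (phase $k$), with $\alpha_k=2^{\lfloor\log_2(B+D)\rfloor+1-k}$: (i) Bike step: while an improvement is possible, choose $i^\star$ maximizing $c_i(d_i,b_i)-c_i(d_i-\alpha_k,b_i+\alpha_k)$ and $j^\star$ maximizing $c_j(d_j,b_j)-c_j(d_j+\alpha_k,b_j-\alpha_k)$, and, if $c_{i^\star}(d_{i^\star},b_{i^\star})+c_{j^\star}(d_{j^\star},b_{j^\star})>c_{i^\star}(d_{i^\star}-\alpha_k,b_{i^\star}+\alpha_k)+c_{j^\star}(d_{j^\star}+\alpha_k,b_{j^\star}-\alpha_k)$, move $\alpha_k$ bikes from $j^\star$ to $i^\star$ (i.e. $d_{i^\star}$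 decreases and $b_{i^\star}$ increases by $\alpha_k$, $d_{j^\star}$ increases and $b_{j^\star}$ decreases by $\alpha_k$); otherwise end the bike step. (ii) Gradient-descent steps: while the minimum of $c$ over $N^{\alpha_k}(\vec d,\vec b)$ is strictly smaller than $c(\vec d,\vec b)$, replace $(\vec d,\vec b)$ by a minimizer of $c$ over $N^{\alpha_k}(\vec d,\vec b)$. After the last phase return $(\vec d,\vec b)$. "Iterations" are the gradient-descent steps in (ii), counted over all phases. The constant in $O(\cdot)$ is absolute (independent of the instance), and the $O$-bound is understood for $B+D\ge 2$. *)

theory Defs
  imports "HOL-Probability.Probability"
begin

(* The number delta_t of open docks after the first t arrivals; X_t of the mathematical
   notation is X ! (t - 1). *)
primrec open_docks :: "int list \<Rightarrow> int \<Rightarrow> int \<Rightarrow> nat \<Rightarrow> int" where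
  "open_docks X d b 0 = d"
| "open_docks X d b (Suc t) = max 0 (min (d + b) (open_docks X d b t - X ! t))"

definition seq_cost :: "int list \<Rightarrow> int \<Rightarrow> int \<Rightarrow> nat" where
  "seq_cost X d b =
     card {t. t < length X \<and> X ! t = 1 \<and> open_docks X d b t = 0} +
     card {t. t < length X \<and> X ! t = - 1 \<and> open_docks X d b t = d + b}"

record bike_system =
  num_stations :: nat
  total_open :: nat      (* D *)
  total_bikes :: nat     (* B *)
  demand :: "nat \<Rightarrow> int list pmf"
  lower :: "nat \<Rightarrow> nat"
  upper :: "nat \<Rightarrow> nat"
  depot :: "nat option"  (* the depot station, if there is one *)

abbreviation stations :: "bike_system \<Rightarrow> nat set" where
  "stations S \<equiv> {1..num_stations S}"

definition valid_system :: "bike_system \<Rightarrow> bool" where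
  "valid_system S \<longleftrightarrow>
     total_bikes S + total_open S \<ge> 1 \<and>
     (\<forall>i\<in>stations S. set_pmf (demand S i) \<subseteq> lists {1, - 1}) \<and>
     (\<forall>i\<in>stations S. lower S i \<le> upper S i) \<and>
     (\<forall>i. depot S = Some i \<longrightarrow> i \<in> stations S)"

(* The expectation of the nonnegative cost is taken in [0, \<infinity>]; it may be infinite also at
   points satisfying the capacity bounds. *)
definition station_cost :: "bike_system \<Rightarrow> nat \<Rightarrow> int \<Rightarrow> int \<Rightarrow> ereal" where
  "station_cost S i d b =
     (if d \<ge> 0 \<and> b \<ge> 0 \<and> int (lower S i) \<le> d + b \<and> d + b \<le> int (upper S i)
      then if depot S = Some i
           then ereal (real_of_int (d + b - int (lower S i)))
           else enn2ereal (\<integral>\<^sup>+ X. of_nat (seq_cost X d b) \<partial>measure_pmf (demand S i))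
      else \<infinity>)"

(* A pair (d, b) of integer vectors; only the entries at indices in stations S matter. *)
type_synonym config = "(nat \<Rightarrow> int) \<times> (nat \<Rightarrow> int)"

definition cost :: "bike_system \<Rightarrow> config \<Rightarrow> ereal" where
  "cost S x = (\<Sum>i\<in>stations S. station_cost S i (fst x i) (snd x i))"

definition allocation :: "bike_system \<Rightarrow> config \<Rightarrow> bool" where
  "allocation S x \<longleftrightarrow>
     (\<Sum>i\<in>stations S. fst x i + snd x i) = int (total_open S + total_bikes S) \<and>
     (\<Sum>i\<in>stations S. snd x i) = int (total_bikes S)"

definition optimal :: "bike_system \<Rightarrow> config \<Rightarrow> bool" where
  "optimal S x \<longleftrightarrow> is_arg_min (cost S) (allocation S) x"

definition transfer_units :: "int \<Rightarrow> nat \<Rightarrow> nat \<Rightarrow> (nat \<Rightarrow> int) \<Rightarrow> nat \<Rightarrow> int" where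
  "transfer_units \<alpha> i j v = (\<lambda>m. v m - (if m = i then \<alpha> else 0) + (if m = j then \<alpha> else 0))"

definition move_o :: "int \<Rightarrow> nat \<Rightarrow> nat \<Rightarrow> config \<Rightarrow> config" where
  "move_o \<alpha> i j = (\<lambda>(d, b). (transfer_units \<alpha> i j d, b))"

definition move_e :: "int \<Rightarrow> nat \<Rightarrow> nat \<Rightarrow> config \<Rightarrow> config" where
  "move_e \<alpha> i j = (\<lambda>(d, b). (d, transfer_units \<alpha> i j b))"

definition move_E :: "int \<Rightarrow> nat \<Rightarrow> nat \<Rightarrow> nat \<Rightarrow> config \<Rightarrow> config" where
  "move_E \<alpha> i j h = (\<lambda>(d, b). (transfer_units \<alpha> i h d, transfer_units \<alpha> h j b))"

definition move_O :: "int \<Rightarrow> nat \<Rightarrow> nat \<Rightarrow> nat \<Rightarrow> config \<Rightarrow> config" where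
  "move_O \<alpha> i j h = (\<lambda>(d, b). (transfer_units \<alpha> h j d, transfer_units \<alpha> i h b))"

(* The station h may coincide with i or j. *)
definition neighbourhood :: "bike_system \<Rightarrow> int \<Rightarrow> config \<Rightarrow> config set" where
  "neighbourhood S \<alpha> x =
     {y. allocation S y \<and>
         (\<exists>i\<in>stations S. \<exists>j\<in>stations S. \<exists>h\<in>stations S. i \<noteq> j \<and>
            y \<in> {move_o \<alpha> i j x, move_e \<alpha> i j x, move_E \<alpha> i j h x, move_O \<alpha> i j h x})}"

definition last_phase :: "bike_system \<Rightarrow> nat" where
  "last_phase S = nat \<lfloor>log 2 (real (total_bikes S + total_open S))\<rfloor> + 1"

definition step_size :: "bike_system \<Rightarrow> nat \<Rightarrow> int" where
  "step_size S k = 2 ^ (last_phase S - k)"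

(* Decrease of the cost of station i when it receives or gives up \<alpha> bikes. The convention
   \<infinity> - \<infinity> = \<infinity> of ereal plays no role at configurations of finite cost. *)
definition gain_receive :: "bike_system \<Rightarrow> int \<Rightarrow> config \<Rightarrow> nat \<Rightarrow> ereal" where
  "gain_receive S \<alpha> x i =
     station_cost S i (fst x i) (snd x i) - station_cost S i (fst x i - \<alpha>) (snd x i + \<alpha>)"

definition gain_give :: "bike_system \<Rightarrow> int \<Rightarrow> config \<Rightarrow> nat \<Rightarrow> ereal" where
  "gain_give S \<alpha> x j =
     station_cost S j (fst x j) (snd x j) - station_cost S j (fst x j + \<alpha>) (snd x j - \<alpha>)"

definition bike_choice :: "bike_system \<Rightarrow> int \<Rightarrow> config \<Rightarrow> nat \<Rightarrow> nat \<Rightarrow> bool" where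
  "bike_choice S \<alpha> x i j \<longleftrightarrow>
     is_arg_max (gain_receive S \<alpha> x) (\<lambda>m. m \<in> stations S) i \<and>
     is_arg_max (gain_give S \<alpha> x) (\<lambda>m. m \<in> stations S) j"

definition bike_improves :: "bike_system \<Rightarrow> int \<Rightarrow> config \<Rightarrow> nat \<Rightarrow> nat \<Rightarrow> bool" where
  "bike_improves S \<alpha> x i j \<longleftrightarrow>
     station_cost S i (fst x i) (snd x i) + station_cost S j (fst x j) (snd x j) >
     station_cost S i (fst x i - \<alpha>) (snd x i + \<alpha>) + station_cost S j (fst x j + \<alpha>) (snd x j - \<alpha>)"

definition move_bikes :: "int \<Rightarrow> nat \<Rightarrow> nat \<Rightarrow> config \<Rightarrow> config" where
  "move_bikes \<alpha> j i = (\<lambda>(d, b). (transfer_units \<alpha> i j d, transfer_units \<alpha> j i b))"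

(* The algorithm as a transition system. Bike k x and Descent k x: the bike step,
   respectively the gradient-descent part, of phase k with current solution x; Finished x: x has
   been returned. Nondeterminism is arbitrary tie-breaking among maximizers and minimizers. *)
datatype alg_state = Bike nat config | Descent nat config | Finished config

(* The middle argument is the contribution of the transition to the iteration count. *)
inductive alg_step :: "bike_system \<Rightarrow> alg_state \<Rightarrow> nat \<Rightarrow> alg_state \<Rightarrow> bool"
  for S :: bike_system where
  bike_move:
    "bike_choice S (step_size S k) x i j \<Longrightarrow> bike_improves S (step_size S k) x i j \<Longrightarrow>
     alg_step S (Bike k x) 0 (Bike k (move_bikes (step_size S k) j i x))"
| bike_end:
    "bike_choice S (step_size S k) x i j \<Longrightarrow> \<not> bike_improves S (step_size S k) x i j \<Longrightarrow>
     alg_step S (Bike k x) 0 (Descent k x)"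
| descent_move:
    "is_arg_min (cost S) (\<lambda>z. z \<in> neighbourhood S (step_size S k) x) y \<Longrightarrow> cost S y < cost S x \<Longrightarrow>
     alg_step S (Descent k x) 1 (Descent k y)"
| descent_end:
    "\<not> (\<exists>y\<in>neighbourhood S (step_size S k) x. cost S y < cost S x) \<Longrightarrow>
     alg_step S (Descent k x) 0 (if k < last_phase S then Bike (Suc k) x else Finished x)"

inductive alg_run :: "bike_system \<Rightarrow> alg_state \<Rightarrow> nat \<Rightarrow> alg_state \<Rightarrow> bool"
  for S :: bike_system where
  refl: "alg_run S s 0 s"
| step: "alg_run S s q s' \<Longrightarrow> alg_step S s' r s'' \<Longrightarrow> alg_run S s (q + r) s''"

definition terminates_from :: "bike_system \<Rightarrow> alg_state \<Rightarrow> bool" where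
  "terminates_from S s \<longleftrightarrow>
     \<not> (\<exists>f :: nat \<Rightarrow> alg_state. f 0 = s \<and> (\<forall>m. \<exists>r. alg_step S (f m) r (f (Suc m))))"

end

theory Submission
  imports Defs
begin

text \<open>Throughout, a configuration is seen as a point with three coordinates at every station: the open docks \<open>d\<close>,
the bikes \<open>b\<close>, and the absent docks \<open>- (d + b)\<close>. Differences of two allocations then form a matrix with
three rows and one column per station in which all rows and all columns sum to zero.

Convexity. In the plane with the three coordinates \<open>d\<close>, \<open>b\<close>, \<open>d + b\<close>, call \<open>z\<close> between \<open>x\<close> and \<open>y\<close> if
each of the three coordinates of \<open>z\<close> lies between those of \<open>x\<close> and \<open>y\<close>. The cost of a station satisfies
\<open>c z + c (x + y - z) \<le> c x + c y\<close> for all such \<open>z\<close> (\<open>station_cost_exchange\<close>). For a single arrival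
sequence this follows from multimodularity, which is proved by induction on the sequence; the inequality
is linear in \<open>c\<close>, hence survives the expectation. It does not mention unit steps, so it can be used for
moves of every size \<open>\<alpha>\<close> alike. This is why scaling works.

Circuits. A zero-sum matrix with three rows is a sum of sign-compatible circuits with four or six nonzero
entries. With entries \<open>\<plusminus>\<alpha>\<close> these circuits are exactly the moves \<open>o\<close>, \<open>e\<close> and the bike moves (four entries)
and the moves \<open>E\<close> and \<open>O\<close> (six entries). Whenever two allocations \<open>x\<close> and \<open>y\<close> that are congruent
modulo \<open>\<alpha>\<close> differ, some move of size \<open>\<alpha>\<close> therefore leads from \<open>x\<close> to a point \<open>z\<close> between them, and \<open>cost z + cost (x + y - z) \<le> cost x + cost y\<close> trades the move off against \<open>y\<close>.
Three consequences drive the analysis.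

First, a point that no move of size \<open>\<alpha>\<close> improves is optimal among all allocations congruent to it
modulo \<open>\<alpha>\<close> (\<open>locally_optimal_class_optimal\<close>). At \<open>\<alpha> = 1\<close> this is global optimality. Bike moves are not
part of the descent neighbourhood, but a descent step preserves the absence of improving bike moves.

Second, from a point \<open>x\<close> that no bike move improves, a descent step decreases the dock distance
\<open>\<Sum>\<bar>(d + b) - (d' + b')\<bar>\<close> to the nearest optimum of the congruence class by at least \<open>2 \<alpha>\<close>
(\<open>descent_step\<close>): some nearest optimum has fewer docks than \<open>x\<close> at the station
that loses and more at the station that gains.

Third, a point that no move of size \<open>2 \<alpha>\<close> improves lies within dock distance \<open>O(n \<alpha>)\<close> of an optimum for
step size \<open>\<alpha>\<close> (\<open>proximity\<close>): no circuit of size \<open>2 \<alpha>\<close> fits between it and the nearest such optimum, and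
this bounds the difference matrix row by row.

Each phase thus has \<open>O(n)\<close> descent steps, and there are \<open>O(log (B + D))\<close> phases. The bike step changes
no dock numbers and so leaves the distance bound intact.\<close>

section \<open>Multimodularity of the cost of one arrival sequence\<close>

text \<open>Of the six directions \<open>\<plusminus>(1,0)\<close>, \<open>\<plusminus>(0,1)\<close>, \<open>\<plusminus>(1,-1)\<close>, adjacent ones span cones; the three inequalities say
that increments along one generator of a cone grow along the other. In the plane this notion
coincides with L-natural- and M-natural-convexity, up to linear changes of coordinates.\<close>
definition multimodular :: "(nat \<Rightarrow> nat \<Rightarrow> int) \<Rightarrow> bool" where
  "multimodular C \<longleftrightarrow> (\<forall>d b.
     C (Suc d) b + C d (Suc b) \<le> C (Suc d) (Suc b) + C d b \<and>
     C (Suc d) b + C (Suc d) (Suc b) \<le> C (Suc (Suc d)) b + C d (Suc b) \<and>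
     C d (Suc b) + C (Suc d) (Suc b) \<le> C d (Suc (Suc b)) + C (Suc d) b)"

text \<open>Two stations of equal capacity that start with one open dock more or less stay exactly one apart until one of
them turns a customer away, and agree from then on. So their costs differ by at most one, and this bound
settles the boundary cases of the induction on the sequence.\<close>
definition unit_slope :: "(nat \<Rightarrow> nat \<Rightarrow> int) \<Rightarrow> bool" where
  "unit_slope C \<longleftrightarrow>
     (\<forall>d b. C (Suc d) b - C d (Suc b) \<le> 1 \<and> C d (Suc b) - C (Suc d) b \<le> 1)"

text \<open>Convexity along a direction is the sum of the inequalities for the two cones that share the direction.\<close>
lemma multimodular_convex:
  assumes "multimodular C"
  shows "2 * C (Suc d) b \<le> C (Suc (Suc d)) b + C d b"
    and "2 * C d (Suc b) \<le> C d (Suc (Suc b)) + C d b"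
    and "2 * C (Suc d) (Suc b) \<le> C (Suc (Suc d)) b + C d (Suc (Suc b))"
  using assms unfolding multimodular_def by (smt (verit))+

lemma multimodular_swap: "multimodular C \<Longrightarrow> multimodular (\<lambda>d b. C b d)"
  unfolding multimodular_def by (smt (verit))

lemma unit_slope_swap: "unit_slope C \<Longrightarrow> unit_slope (\<lambda>d b. C b d)"
  unfolding unit_slope_def by blast

text \<open>A first arrival that returns a bike shifts \<open>C\<close> by one along the direction \<open>(-1, 1)\<close>, and at \<open>d = 0\<close>, where
the return fails, extends it with the extreme slope \<open>-1\<close>. Such an extension stays convex because of \<open>unit_slope\<close>.\<close>
lemma multimodular_return_step:
  assumes "multimodular C" "unit_slope C"
  defines "C' \<equiv> \<lambda>d b. case d of 0 \<Rightarrow> 1 + C 0 b | Suc d' \<Rightarrow> C d' (Suc b)"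
  shows "multimodular C'" "unit_slope C'"
proof -
  have m: "C (Suc d) b + C d (Suc b) \<le> C (Suc d) (Suc b) + C d b"
     "C (Suc d) b + C (Suc d) (Suc b) \<le> C (Suc (Suc d)) b + C d (Suc b)"
     "C d (Suc b) + C (Suc d) (Suc b) \<le> C d (Suc (Suc b)) + C (Suc d) b" for d b
    using assms(1) unfolding multimodular_def by auto
  have s: "C (Suc d) b - C d (Suc b) \<le> 1" "C d (Suc b) - C (Suc d) b \<le> 1" for d b
    using assms(2) unfolding unit_slope_def by blast+
  note c = multimodular_convex[OF assms(1)]
  show "multimodular C'"
    unfolding multimodular_def
  proof (intro allI conjI)
    fix d b
    show "C' (Suc d) b + C' d (Suc b) \<le> C' (Suc d) (Suc b) + C' d b"
      using c(2)[of 0 b] m(1)[of "d - 1" "Suc b"] by (cases d) (auto simp: C'_def)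
    show "C' (Suc d) b + C' (Suc d) (Suc b) \<le> C' (Suc (Suc d)) b + C' d (Suc b)"
      using s(2)[of 0 "Suc b"] m(2)[of "d - 1" "Suc b"] by (cases d) (auto simp: C'_def)
    show "C' d (Suc b) + C' (Suc d) (Suc b) \<le> C' d (Suc (Suc b)) + C' (Suc d) b"
      using m(3)[of "d - 1" "Suc b"] by (cases d) (auto simp: C'_def)
  qed
  show "unit_slope C'"
    unfolding unit_slope_def
  proof (intro allI conjI)
    fix d b
    show "C' (Suc d) b - C' d (Suc b) \<le> 1" "C' d (Suc b) - C' (Suc d) b \<le> 1"
      using s[of "d - 1" "Suc b"] by (cases d; simp add: C'_def)+
  qed
qed

lemma open_docks_Cons:
  assumes "\<delta> = max 0 (min (d + b) (d - x))"
  shows "open_docks (x # X) d b (Suc t) = open_docks X \<delta> (d + b - \<delta>) t"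
proof (induction t)
  case 0
  show ?case unfolding assms by (simp only: open_docks.simps nth_Cons_0)
next
  case (Suc t)
  have "open_docks (x # X) d b (Suc (Suc t)) =
      max 0 (min (d + b) (open_docks (x # X) d b (Suc t) - X ! t))"
    by (simp only: open_docks.simps nth_Cons_Suc)
  also have "\<dots> = open_docks X \<delta> (d + b - \<delta>) (Suc t)"
    unfolding Suc.IH by (simp add: algebra_simps)
  finally show ?case .
qed

lemma card_less_Suc_shift:
  "card {t. t < Suc n \<and> P t} = (if P 0 then 1 else 0) + card {t. t < n \<and> P (Suc t)}"
proof -
  have "{t. t < Suc n \<and> P t} = (if P 0 then {0} else {}) \<union> Suc ` {t. t < n \<and> P (Suc t)}"
    by (auto simp: image_iff less_Suc_eq_0_disj)
  then show ?thesis by (auto simp: card_image)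
qed

lemma seq_cost_Cons:
  assumes "\<delta> = max 0 (min (d + b) (d - x))"
  shows "seq_cost (x # X) d b =
     (if x = 1 \<and> d = 0 then 1 else 0) + (if x = - 1 \<and> b = 0 then 1 else 0) +
     seq_cost X \<delta> (d + b - \<delta>)"
  unfolding seq_cost_def length_Cons card_less_Suc_shift open_docks_Cons[OF assms]
  by (simp cong: conj_cong)

text \<open>Rentals are returns with the roles of bikes and open docks exchanged, so the single step above serves both
kinds of arrival.\<close>
lemma seq_cost_multimodular:
  assumes "set X \<subseteq> {1, - 1}"
  shows "multimodular (\<lambda>d b. int (seq_cost X (int d) (int b))) \<and>
         unit_slope (\<lambda>d b. int (seq_cost X (int d) (int b)))"
  using assms
proof (induction X)
  case Nil
  then show ?case by (simp add: multimodular_def unit_slope_def seq_cost_def)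
next
  case (Cons x X)
  define C where "C = (\<lambda>d b. int (seq_cost X (int d) (int b)))"
  have IH: "multimodular C" "unit_slope C" using Cons by (auto simp: C_def)
  define R where "R C = (\<lambda>d b. case d of 0 \<Rightarrow> 1 + C 0 b | Suc d' \<Rightarrow> C d' (Suc b))"
    for C :: "nat \<Rightarrow> nat \<Rightarrow> int"
  consider "x = 1" | "x = - 1" using Cons.prems by auto
  then show ?case
  proof cases
    case 1
    then have "(\<lambda>d b. int (seq_cost (x # X) (int d) (int b))) = R C"
      unfolding C_def R_def by (auto simp: seq_cost_Cons[OF HOL.refl] fun_eq_iff add.commute split: nat.split)
    then show ?thesis
      using multimodular_return_step[OF IH] by (simp add: R_def)
  next
    case 2
    have "(\<lambda>d b. int (seq_cost (x # X) (int d) (int b))) = (\<lambda>d b. R (\<lambda>d b. C b d) b d)"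
      unfolding C_def R_def using 2
      by (auto simp: seq_cost_Cons[OF HOL.refl] fun_eq_iff algebra_simps split: nat.split)
    moreover have "multimodular (R (\<lambda>d b. C b d))" "unit_slope (R (\<lambda>d b. C b d))"
      using multimodular_return_step[OF multimodular_swap[OF IH(1)] unit_slope_swap[OF IH(2)]]
      by (simp_all add: R_def)
    ultimately show ?thesis
      using multimodular_swap unit_slope_swap by metis
  qed
qed

section \<open>The exchange inequality\<close>

text \<open>A function on a grid whose second differences are all nonnegative has increments over a fixed translation
\<open>(s, t)\<close> that are smallest at the origin; take \<open>(s, t) = (p - p', q - q')\<close> and translate from \<open>(p', q')\<close>.\<close>
lemma grid_exchange:
  fixes G :: "nat \<Rightarrow> nat \<Rightarrow> int"
  assumes sup: "\<And>a c. Suc a \<le> p \<Longrightarrow> Suc c \<le> q \<Longrightarrow>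
                  G (Suc a) c + G a (Suc c) \<le> G (Suc a) (Suc c) + G a c"
    and cv1: "\<And>a c. Suc (Suc a) \<le> p \<Longrightarrow> c \<le> q \<Longrightarrow> 2 * G (Suc a) c \<le> G (Suc (Suc a)) c + G a c"
    and cv2: "\<And>a c. a \<le> p \<Longrightarrow> Suc (Suc c) \<le> q \<Longrightarrow> 2 * G a (Suc c) \<le> G a (Suc (Suc c)) + G a c"
    and "p' \<le> p" "q' \<le> q"
  shows "G p' q' + G (p - p') (q - q') \<le> G 0 0 + G p q"
proof -
  have D1: "G (Suc a) c - G a c \<le> G (Suc (a + s)) (c + t) - G (a + s) (c + t)"
    if "Suc (a + s) \<le> p" "c + t \<le> q" for a c s t
  proof -
    have "G (Suc a) c - G a c \<le> G (Suc a) (c + t) - G a (c + t)"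
      using that(2)
    proof (induction t)
      case (Suc t)
      then show ?case using sup[of a "c + t"] that(1) by simp
    qed simp
    also have "\<dots> \<le> G (Suc (a + s)) (c + t) - G (a + s) (c + t)"
      using that(1)
    proof (induction s)
      case (Suc s)
      then show ?case using cv1[of "a + s" "c + t"] that(2) by simp
    qed simp
    finally show ?thesis .
  qed
  have D2: "G a (Suc c) - G a c \<le> G (a + s) (Suc (c + t)) - G (a + s) (c + t)"
    if "a + s \<le> p" "Suc (c + t) \<le> q" for a c s t
  proof -
    have "G a (Suc c) - G a c \<le> G (a + s) (Suc c) - G (a + s) c"
      using that(1)
    proof (induction s)
      case (Suc s)
      then show ?case using sup[of "a + s" c] that(2) by simp
    qed simp
    also have "\<dots> \<le> G (a + s) (Suc (c + t)) - G (a + s) (c + t)"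
      using that(2)
    proof (induction t)
      case (Suc t)
      then show ?case using cv2[of "a + s" "c + t"] that(1) by simp
    qed simp
    finally show ?thesis .
  qed
  have r1: "G s t - G 0 0 \<le> G (a + s) t - G a 0" if "a + s \<le> p" "t \<le> q" for a s t
    using that(1)
  proof (induction a)
    case (Suc a)
    then show ?case using D1[of a s 0 t] that(2) by (simp)
  qed simp
  have r2: "G s t - G 0 0 \<le> G (a + s) (c + t) - G a c" if "a + s \<le> p" "c + t \<le> q" for a c s t
    using that(2)
  proof (induction c)
    case 0
    then show ?case using r1 that(1) by simp
  next
    case (Suc c)
    then show ?case using D2[of a s c t] that(1) by (simp)
  qed
  show ?thesis using r2[of p' "p - p'" q' "q - q'"] assms(4,5) by simp
qed

definition between :: "int \<Rightarrow> int \<Rightarrow> int \<Rightarrow> bool" where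
  "between a c b \<longleftrightarrow> a \<le> b \<and> b \<le> c \<or> c \<le> b \<and> b \<le> a"

text \<open>The points \<open>(d, b)\<close> with this property form the parallelogram spanned from \<open>(d1, b1)\<close> to \<open>(d2, b2)\<close> by the
two adjacent directions among \<open>\<plusminus>(1,0)\<close>, \<open>\<plusminus>(0,1)\<close>, \<open>\<plusminus>(1,-1)\<close> whose cone contains the difference.\<close>
definition hex_between :: "int \<Rightarrow> int \<Rightarrow> int \<Rightarrow> int \<Rightarrow> int \<Rightarrow> int \<Rightarrow> bool" where
  "hex_between d1 b1 d2 b2 d b \<longleftrightarrow>
     between d1 d2 d \<and> between b1 b2 b \<and> between (d1 + b1) (d2 + b2) (d + b)"

text \<open>In each of the three cones with \<open>d1 \<le> d2\<close>, the parallelogram is a grid to which \<open>grid_exchange\<close> applies; its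
second differences are those of multimodularity and of \<open>multimodular_convex\<close>.\<close>
lemma multimodular_exchange:
  fixes d1 b1 d2 b2 d b :: nat
  assumes C: "multimodular C"
    and "d1 \<le> d2" "d1 \<le> d" "d \<le> d2"
    and "between (int b1) (int b2) (int b)" "between (d1 + b1) (d2 + b2) (d + b)"
  shows "C d b + C (d1 + d2 - d) (b1 + b2 - b) \<le> C d1 b1 + C d2 b2"
proof -
  note m = C[unfolded multimodular_def, rule_format]
  note m1 = m[THEN conjunct1] and m2 = m[THEN conjunct2, THEN conjunct1]
   and m3 = m[THEN conjunct2, THEN conjunct2]
  note c = multimodular_convex[OF C]
  consider (same) "b1 \<le> b2" "b1 \<le> b" "b \<le> b2"
    | (grow) "b2 < b1" "b2 \<le> b" "b \<le> b1" "d1 + b1 \<le> d + b" "d + b \<le> d2 + b2"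
    | (shrink) "b2 < b1" "d2 + b2 \<le> d + b" "d + b \<le> d1 + b1"
    using assms unfolding between_def by linarith
  then show ?thesis
  proof cases
    case same
    obtain p p' q q' where [simp]: "d = d1 + p" "d2 = d + p'" "b = b1 + q" "b2 = b + q'"
      using same assms(3,4) by (metis le_iff_add)
    show ?thesis
      using grid_exchange[of "p + p'" "q + q'" "\<lambda>i j. C (d1 + i) (b1 + j)" p q] m1 c(1,2)
      by (simp add: add_ac)
  next
    case grow
    obtain e e' k k' where [simp]: "b = b2 + e" "b1 = b + e'" "d + b = d1 + b1 + k" "d2 + b2 = d + b + k'"
      using grow by (metis le_iff_add)
    have [simp]: "d = d1 + e' + k" "d2 = d1 + (e + e') + (k + k')"
      using \<open>d + b = _\<close> \<open>d2 + b2 = _\<close> unfolding \<open>b1 = _\<close> \<open>b = _\<close> by linarith+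
    define G where "G = (\<lambda>i j. C (d1 + i + j) (b2 + (e + e' - i)))"
    have "G e' k + G (e + e' - e') (k + k' - k) \<le> G 0 0 + G (e + e') (k + k')"
    proof (rule grid_exchange)
      fix i j assume "Suc i \<le> e + e'"
      then obtain r where "e + e' = Suc i + r" by (metis le_iff_add)
      then show "G (Suc i) j + G i (Suc j) \<le> G (Suc i) (Suc j) + G i j"
        using m2[of "d1 + i + j" "b2 + r"] by (simp add: G_def Suc_diff_le)
    next
      fix i j assume "Suc (Suc i) \<le> e + e'"
      then obtain r where "e + e' = Suc (Suc i) + r" by (metis le_iff_add)
      then show "2 * G (Suc i) j \<le> G (Suc (Suc i)) j + G i j"
        using c(3)[of "d1 + i + j" "b2 + r"] by (simp add: G_def Suc_diff_le)
    next
      fix i j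
      show "2 * G i (Suc j) \<le> G i (Suc (Suc j)) + G i j"
        using c(1)[of "d1 + i + j"] by (simp add: G_def)
    qed simp_all
    then show ?thesis by (simp add: G_def add_ac)
  next
    case shrink
    obtain a a' k k' where [simp]: "d = d1 + a'" "d2 = d + a" "d + b = d2 + b2 + k" "d1 + b1 = d + b + k'"
      using shrink assms(3,4) by (metis le_iff_add)
    have [simp]: "b = b2 + a + k" "b1 = b2 + (a + a') + (k + k')"
      using \<open>d + b = _\<close> \<open>d1 + b1 = _\<close> unfolding \<open>d2 = _\<close> \<open>d = _\<close> by linarith+
    define G where "G = (\<lambda>i j. C (d1 + (a + a' - i)) (b2 + i + j))"
    have "G a k + G (a + a' - a) (k + k' - k) \<le> G 0 0 + G (a + a') (k + k')"
    proof (rule grid_exchange)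
      fix i j assume "Suc i \<le> a + a'"
      then obtain r where "a + a' = Suc i + r" by (metis le_iff_add)
      then show "G (Suc i) j + G i (Suc j) \<le> G (Suc i) (Suc j) + G i j"
        using m3[of "d1 + r" "b2 + i + j"] by (simp add: G_def Suc_diff_le)
    next
      fix i j assume "Suc (Suc i) \<le> a + a'"
      then obtain r where "a + a' = Suc (Suc i) + r" by (metis le_iff_add)
      then show "2 * G (Suc i) j \<le> G (Suc (Suc i)) j + G i j"
        using c(3)[of "d1 + r" "b2 + i + j"] by (simp add: G_def Suc_diff_le)
    next
      fix i j
      show "2 * G i (Suc j) \<le> G i (Suc (Suc j)) + G i j"
        using c(2)[of _ "b2 + i + j"] by (simp add: G_def)
    qed simp_all
    then show ?thesis by (simp add: G_def add_ac)
  qed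
qed

lemma between_lower: "between a c b \<Longrightarrow> l \<le> a \<Longrightarrow> l \<le> c \<Longrightarrow> l \<le> b \<and> l \<le> a + c - b"
  and between_upper: "between a c b \<Longrightarrow> a \<le> u \<Longrightarrow> c \<le> u \<Longrightarrow> b \<le> u \<and> a + c - b \<le> u"
  unfolding between_def by linarith+

lemma between_commute: "between a c b \<longleftrightarrow> between c a b"
  by (auto simp: between_def)

lemma hex_between_commute: "hex_between d1 b1 d2 b2 d b \<longleftrightarrow> hex_between d2 b2 d1 b1 d b"
  unfolding hex_between_def by (simp add: between_commute)

lemma seq_cost_exchange:
  assumes X: "set X \<subseteq> {1, - 1}"
    and hex: "hex_between d1 b1 d2 b2 d b"
    and nonneg: "0 \<le> d1" "0 \<le> b1" "0 \<le> d2" "0 \<le> b2"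
  shows "seq_cost X d b + seq_cost X (d1 + d2 - d) (b1 + b2 - b) \<le> seq_cost X d1 b1 + seq_cost X d2 b2"
  using hex nonneg
proof (induction d1 d2 arbitrary: b1 b2 rule: linorder_wlog)
  case (le d1 d2)
  then have btw: "between d1 d2 d" "between b1 b2 b" "between (d1 + b1) (d2 + b2) (d + b)"
    by (auto simp: hex_between_def)
  have nonneg: "0 \<le> d" "0 \<le> b" "d \<le> d1 + d2" "b \<le> b1 + b2" and "d1 \<le> d" "d \<le> d2"
    using between_lower[OF btw(1), of 0] between_lower[OF btw(2), of 0] between_lower[OF btw(1), of d1]
      between_upper[OF btw(1), of d2] le by linarith+
  define m1 n1 m2 n2 m n where "m1 = nat d1" "n1 = nat b1" "m2 = nat d2" "n2 = nat b2"
      "m = nat d" "n = nat b"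
  then have eq: "d1 = int m1" "b1 = int n1" "d2 = int m2" "b2 = int n2" "d = int m" "b = int n"
    using le.prems(2-) nonneg by simp_all
  have "int (seq_cost X (int m) (int n)) + int (seq_cost X (int (m1 + m2 - m)) (int (n1 + n2 - n))) \<le>
      int (seq_cost X (int m1) (int n1)) + int (seq_cost X (int m2) (int n2))"
    using seq_cost_multimodular[OF X] \<open>d1 \<le> d\<close> \<open>d \<le> d2\<close> btw le.hyps
    by (intro multimodular_exchange[where C = "\<lambda>d b. int (seq_cost X (int d) (int b))"])
       (simp_all add: eq)
  moreover have "int (m1 + m2 - m) = d1 + d2 - d" "int (n1 + n2 - n) = b1 + b2 - b"
    using nonneg(3,4) unfolding eq by (simp_all flip: of_nat_add)
  ultimately show ?case by (simp add: eq)
next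
  case (sym d1 d2)
  then show ?case using sym(1)[of b2 b1] by (metis hex_between_commute add.commute)
qed

lemma station_cost_nonneg: "0 \<le> station_cost S i d b"
  by (auto simp: station_cost_def)

text \<open>The capacity bounds constrain \<open>d\<close>, \<open>b\<close> and \<open>d + b\<close> only, so the finite domain contains with two points also the
parallelogram between them. On it the inequality holds for every arrival sequence, hence for the
expectation, whether finite or not.\<close>
lemma station_cost_exchange:
  assumes "valid_system S" "i \<in> stations S"
    and hex: "hex_between d1 b1 d2 b2 d b"
  shows "station_cost S i d b + station_cost S i (d1 + d2 - d) (b1 + b2 - b)
       \<le> station_cost S i d1 b1 + station_cost S i d2 b2"
proof -
  define feas where "feas d b \<longleftrightarrow> d \<ge> 0 \<and> b \<ge> 0 \<and> int (lower S i) \<le> d + b \<and> d + b \<le> int (upper S i)"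
    for d b
  show ?thesis
  proof (cases "feas d1 b1 \<and> feas d2 b2")
    case False
    then have "station_cost S i d1 b1 = \<infinity> \<or> station_cost S i d2 b2 = \<infinity>"
      by (auto simp: station_cost_def feas_def)
    then have "station_cost S i d1 b1 + station_cost S i d2 b2 = \<infinity>"
      by auto
    then show ?thesis by (metis ereal_less_eq(1))
  next
    case True
    then have f: "feas d1 b1" "feas d2 b2" by auto
    have btw: "between d1 d2 d" "between b1 b2 b" "between (d1 + b1) (d2 + b2) (d + b)"
      using hex by (auto simp: hex_between_def)
    have "feas d b \<and> feas (d1 + d2 - d) (b1 + b2 - b)"
      using f between_lower[OF btw(1), of 0] between_lower[OF btw(2), of 0]
        between_lower[OF btw(3), of "int (lower S i)"] between_upper[OF btw(3), of "int (upper S i)"]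
      unfolding feas_def by linarith
    note f = f this
    show ?thesis
    proof (cases "depot S = Some i")
      case True
      then show ?thesis using f by (simp add: station_cost_def feas_def)
    next
      case False
      define E where "E d b = (\<integral>\<^sup>+ X. of_nat (seq_cost X d b) \<partial>measure_pmf (demand S i))" for d b
      have "E d b + E (d1 + d2 - d) (b1 + b2 - b) =
         (\<integral>\<^sup>+ X. of_nat (seq_cost X d b + seq_cost X (d1 + d2 - d) (b1 + b2 - b)) \<partial>measure_pmf (demand S i))"
        unfolding E_def by (simp add: nn_integral_add)
      also have "\<dots> \<le> (\<integral>\<^sup>+ X. of_nat (seq_cost X d1 b1 + seq_cost X d2 b2) \<partial>measure_pmf (demand S i))"
      proof (rule nn_integral_mono_AE, rule AE_pmfI)
        fix X assume "X \<in> set_pmf (demand S i)"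
        then have "X \<in> lists {1, - 1}" using assms(1,2) unfolding valid_system_def by blast
        then have "set X \<subseteq> {1, - 1}" by (simp add: lists_eq_set)
        then show "of_nat (seq_cost X d b + seq_cost X (d1 + d2 - d) (b1 + b2 - b))
            \<le> (of_nat (seq_cost X d1 b1 + seq_cost X d2 b2) :: ennreal)"
          using seq_cost_exchange[OF _ hex] f unfolding feas_def of_nat_le_iff by blast
      qed
      also have "\<dots> = E d1 b1 + E d2 b2"
        unfolding E_def by (simp add: nn_integral_add)
      finally have "E d b + E (d1 + d2 - d) (b1 + b2 - b) \<le> E d1 b1 + E d2 b2" .
      then have "enn2ereal (E d b + E (d1 + d2 - d) (b1 + b2 - b)) \<le> enn2ereal (E d1 b1 + E d2 b2)"
        by (simp only: less_eq_ennreal.rep_eq)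
      then show ?thesis using False f unfolding feas_def
        by (simp add: station_cost_def E_def plus_ennreal.rep_eq)
    qed
  qed
qed

section \<open>Moves between two allocations\<close>

definition docks :: "config \<Rightarrow> nat \<Rightarrow> int" where
  "docks x i = fst x i + snd x i"

definition reflect :: "config \<Rightarrow> config \<Rightarrow> config \<Rightarrow> config" where
  "reflect x y z = (\<lambda>i. fst x i + fst y i - fst z i, \<lambda>i. snd x i + snd y i - snd z i)"

text \<open>If \<open>z\<close> is conformal, then so is its mirror image \<open>reflect x y z = x + y - z\<close>, and going from \<open>x\<close> to \<open>z\<close> is one
part of a path from \<open>x\<close> to \<open>y\<close> without detours.\<close>
definition conformal :: "bike_system \<Rightarrow> config \<Rightarrow> config \<Rightarrow> config \<Rightarrow> bool" where
  "conformal S x y z \<longleftrightarrow>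
     (\<forall>i\<in>stations S. hex_between (fst x i) (snd x i) (fst y i) (snd y i) (fst z i) (snd z i))"

definition congruent :: "bike_system \<Rightarrow> int \<Rightarrow> config \<Rightarrow> config \<Rightarrow> bool" where
  "congruent S \<alpha> x y \<longleftrightarrow>
     (\<forall>i\<in>stations S. \<alpha> dvd fst y i - fst x i \<and> \<alpha> dvd snd y i - snd x i)"

definition distance :: "bike_system \<Rightarrow> config \<Rightarrow> config \<Rightarrow> int" where
  "distance S x y =
     (\<Sum>i\<in>stations S. \<bar>fst y i - fst x i\<bar> + \<bar>snd y i - snd x i\<bar> + \<bar>docks y i - docks x i\<bar>)"

definition dock_distance :: "bike_system \<Rightarrow> config \<Rightarrow> config \<Rightarrow> int" where
  "dock_distance S x y = (\<Sum>i\<in>stations S. \<bar>docks y i - docks x i\<bar>)"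

text \<open>Counting docks negatively, as absent ones, makes the three amounts at a station sum to zero, and the three
kinds of resource play symmetric roles.\<close>
datatype resource = Open | Bikes | Absent

fun amount :: "config \<Rightarrow> resource \<Rightarrow> nat \<Rightarrow> int" where
  "amount x Open i = fst x i"
| "amount x Bikes i = snd x i"
| "amount x Absent i = - docks x i"

text \<open>For \<open>p \<noteq> q\<close>, this is the condition under which replacing \<open>\<beta>\<close> units of \<open>p\<close> by \<open>q\<close> at \<open>i\<close> stays between \<open>x\<close> and \<open>y\<close>.\<close>
definition turns :: "int \<Rightarrow> config \<Rightarrow> config \<Rightarrow> nat \<Rightarrow> resource \<Rightarrow> resource \<Rightarrow> bool" where
  "turns \<beta> x y i p q \<longleftrightarrow> amount y p i + \<beta> \<le> amount x p i \<and> amount x q i + \<beta> \<le> amount y q i"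

lemma docks_reflect [simp]: "docks (reflect x y z) i = docks x i + docks y i - docks z i"
  by (simp add: docks_def reflect_def)

lemma distance_nonneg: "0 \<le> distance S x y"
  unfolding distance_def by (rule sum_nonneg) simp

lemma dock_distance_nonneg: "0 \<le> dock_distance S x y"
  unfolding dock_distance_def by (rule sum_nonneg) simp

lemma cost_nonneg: "0 \<le> cost S x"
  unfolding cost_def by (rule sum_nonneg) (rule station_cost_nonneg)

lemma cost_cong:
  assumes "\<And>i. i \<in> stations S \<Longrightarrow> fst x i = fst y i \<and> snd x i = snd y i"
  shows "cost S x = cost S y"
  unfolding cost_def using assms by (intro sum.cong) auto

lemma cost_exchange:
  assumes "valid_system S" "conformal S x y z"
  shows "cost S z + cost S (reflect x y z) \<le> cost S x + cost S y"
  unfolding cost_def reflect_def sum.distrib[symmetric] using assms station_cost_exchange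
  by (auto simp: conformal_def intro!: sum_mono)

lemma between_abs:
  "between a c b \<Longrightarrow> \<bar>a + c - b - a\<bar> = \<bar>c - a\<bar> - \<bar>b - a\<bar>"
  unfolding between_def by linarith

text \<open>Conformal points lie on shortest paths, so replacing \<open>y\<close> by the mirror image of a conformal \<open>z \<noteq> x\<close> brings it
strictly closer to \<open>x\<close>.\<close>
lemma distance_reflect:
  assumes "conformal S x y z"
  shows "distance S x (reflect x y z) = distance S x y - distance S x z"
  unfolding distance_def sum_subtractf[symmetric]
proof (rule sum.cong)
  fix i assume "i \<in> stations S"
  then have "between (fst x i) (fst y i) (fst z i)" "between (snd x i) (snd y i) (snd z i)"
     "between (docks x i) (docks y i) (docks z i)"
    using assms by (auto simp: conformal_def hex_between_def docks_def)
  note eqs = this[THEN between_abs]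
  have sum3: "a - b + (c - d) + (e - f) = a + c + e - (b + d + f)" for a b c d e f :: int
    by simp
  show "\<bar>fst (reflect x y z) i - fst x i\<bar> + \<bar>snd (reflect x y z) i - snd x i\<bar> +
       \<bar>docks (reflect x y z) i - docks x i\<bar> =
     \<bar>fst y i - fst x i\<bar> + \<bar>snd y i - snd x i\<bar> + \<bar>docks y i - docks x i\<bar> -
      (\<bar>fst z i - fst x i\<bar> + \<bar>snd z i - snd x i\<bar> + \<bar>docks z i - docks x i\<bar>)"
    unfolding docks_reflect unfolding reflect_def fst_conv snd_conv eqs by (rule sum3)
qed (rule HOL.refl)

lemma distance_pos:
  assumes "i \<in> stations S" "fst z i \<noteq> fst x i \<or> snd z i \<noteq> snd x i"
  shows "0 < distance S x z"
  unfolding distance_def using assms by (intro sum_pos2[of _ i]) auto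

lemma allocation_reflect:
  "allocation S x \<Longrightarrow> allocation S y \<Longrightarrow> allocation S z \<Longrightarrow> allocation S (reflect x y z)"
  by (simp add: allocation_def reflect_def sum.distrib sum_subtractf)

lemma congruent_refl: "congruent S \<alpha> x x"
  by (simp add: congruent_def)

lemma congruent_sym: "congruent S \<alpha> x y \<Longrightarrow> congruent S \<alpha> y x"
  by (simp add: congruent_def dvd_diff_commute)

lemma congruent_trans: "congruent S \<alpha> x y \<Longrightarrow> congruent S \<alpha> y z \<Longrightarrow> congruent S \<alpha> x z"
proof -
  have "\<alpha> dvd c - a" if "\<alpha> dvd b - a" "\<alpha> dvd c - b" for a b c :: int
    using dvd_add[OF that] by simp
  then show "congruent S \<alpha> x y \<Longrightarrow> congruent S \<alpha> y z \<Longrightarrow> congruent S \<alpha> x z"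
    unfolding congruent_def by blast
qed

lemma congruent_multiple: "congruent S (c * \<alpha>) x y \<Longrightarrow> congruent S \<alpha> x y"
  unfolding congruent_def using dvd_mult_right by blast

lemma congruent_reflect:
  assumes "congruent S \<alpha> x y" "congruent S \<alpha> x z"
  shows "congruent S \<alpha> x (reflect x y z)"
  unfolding congruent_def
proof (intro ballI conjI)
  fix i assume i: "i \<in> stations S"
  have "fst (reflect x y z) i - fst x i = (fst y i - fst x i) - (fst z i - fst x i)"
   "snd (reflect x y z) i - snd x i = (snd y i - snd x i) - (snd z i - snd x i)"
    by (simp_all add: reflect_def)
  then show "\<alpha> dvd fst (reflect x y z) i - fst x i" "\<alpha> dvd snd (reflect x y z) i - snd x i"
    using i assms unfolding congruent_def by (metis dvd_diff)+
qed

lemma sum_transfer_units: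
  assumes "i \<in> stations S" "j \<in> stations S"
  shows "(\<Sum>m\<in>stations S. transfer_units \<alpha> i j v m) = (\<Sum>m\<in>stations S. v m)"
  using assms by (simp add: transfer_units_def sum.distrib sum_subtractf)

lemma allocation_move:
  assumes "allocation S x" "i \<in> stations S" "j \<in> stations S" "h \<in> stations S"
  shows "allocation S (move_o \<alpha> i j x)" "allocation S (move_e \<alpha> i j x)"
    "allocation S (move_E \<alpha> i j h x)" "allocation S (move_O \<alpha> i j h x)"
    "allocation S (move_bikes \<alpha> i j x)"
  using assms
  by (auto simp: allocation_def move_o_def move_e_def move_E_def move_O_def move_bikes_def
      sum.distrib sum_transfer_units simp del: One_nat_def split: prod.split)

lemma dvd_transfer_units: "\<alpha> dvd transfer_units \<alpha> i j v m - v m"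
  by (simp add: transfer_units_def)

lemma congruent_move:
  "congruent S \<alpha> x (move_o \<alpha> i j x)" "congruent S \<alpha> x (move_e \<alpha> i j x)"
  "congruent S \<alpha> x (move_E \<alpha> i j h x)" "congruent S \<alpha> x (move_O \<alpha> i j h x)"
  "congruent S \<alpha> x (move_bikes \<alpha> i j x)"
  by (auto simp: congruent_def move_o_def move_e_def move_E_def move_O_def move_bikes_def
      dvd_transfer_units split: prod.split)

text \<open>All four dock moves transfer the capacity \<open>\<alpha>\<close> from \<open>i\<close> to \<open>j\<close>, and the station \<open>h\<close> only mediates. Bike moves change no
capacity.\<close>
lemma docks_move:
  "docks (move_o \<alpha> i j x) = transfer_units \<alpha> i j (docks x)"
  "docks (move_e \<alpha> i j x) = transfer_units \<alpha> i j (docks x)"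
  "docks (move_E \<alpha> i j h x) = transfer_units \<alpha> i j (docks x)"
  "docks (move_O \<alpha> i j h x) = transfer_units \<alpha> i j (docks x)"
  "docks (move_bikes \<alpha> i j x) = docks x"
  by (auto simp: fun_eq_iff docks_def move_o_def move_e_def move_E_def move_O_def move_bikes_def
      transfer_units_def split: prod.split)

lemma neighbourhood_cases:
  assumes "z \<in> neighbourhood S \<alpha> x"
  obtains i j where "i \<in> stations S" "j \<in> stations S" "i \<noteq> j" "allocation S z" "congruent S \<alpha> x z"
    "docks z = transfer_units \<alpha> i j (docks x)"
proof -
  from assms obtain i j h where ijh: "i \<in> stations S" "j \<in> stations S" "i \<noteq> j" "allocation S z"
    and z: "z \<in> {move_o \<alpha> i j x, move_e \<alpha> i j x, move_E \<alpha> i j h x, move_O \<alpha> i j h x}"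
    unfolding neighbourhood_def by blast
  from z have "congruent S \<alpha> x z"
    by (elim insertE emptyE) (simp_all only: congruent_move)
  moreover from z have "docks z = transfer_units \<alpha> i j (docks x)"
    by (elim insertE emptyE) (simp_all only: docks_move)
  ultimately show thesis using ijh that by blast
qed

lemma hex_between_turns:
  assumes "0 \<le> \<beta>"
  shows "turns \<beta> x y i Open Absent \<Longrightarrow>
      hex_between (fst x i) (snd x i) (fst y i) (snd y i) (fst x i - \<beta>) (snd x i)"
    and "turns \<beta> x y i Absent Open \<Longrightarrow>
      hex_between (fst x i) (snd x i) (fst y i) (snd y i) (fst x i + \<beta>) (snd x i)"
    and "turns \<beta> x y i Bikes Absent \<Longrightarrow>
      hex_between (fst x i) (snd x i) (fst y i) (snd y i) (fst x i) (snd x i - \<beta>)"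
    and "turns \<beta> x y i Absent Bikes \<Longrightarrow>
      hex_between (fst x i) (snd x i) (fst y i) (snd y i) (fst x i) (snd x i + \<beta>)"
    and "turns \<beta> x y i Open Bikes \<Longrightarrow>
      hex_between (fst x i) (snd x i) (fst y i) (snd y i) (fst x i - \<beta>) (snd x i + \<beta>)"
    and "turns \<beta> x y i Bikes Open \<Longrightarrow>
      hex_between (fst x i) (snd x i) (fst y i) (snd y i) (fst x i + \<beta>) (snd x i - \<beta>)"
    and "hex_between (fst x i) (snd x i) (fst y i) (snd y i) (fst x i) (snd x i)"
  using assms unfolding hex_between_def between_def turns_def docks_def amount.simps by linarith+

lemma turns_distinct: "0 < \<beta> \<Longrightarrow> turns \<beta> x y u p q \<Longrightarrow> turns \<beta> x y v r p \<Longrightarrow> u \<noteq> v"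
  unfolding turns_def by force

text \<open>The five kinds of moves are the circuits in the difference matrix: every resource that a station of the
circuit gives up is taken up by the next one. Stations with opposite changes are automatically distinct.\<close>
lemma conformal_move:
  assumes "0 < \<beta>"
  shows "turns \<beta> x y u Open Absent \<Longrightarrow> turns \<beta> x y v Absent Open \<Longrightarrow>
      conformal S x y (move_o \<beta> u v x)"
    and "turns \<beta> x y u Bikes Absent \<Longrightarrow> turns \<beta> x y v Absent Bikes \<Longrightarrow>
      conformal S x y (move_e \<beta> u v x)"
    and "turns \<beta> x y u Open Bikes \<Longrightarrow> turns \<beta> x y v Bikes Open \<Longrightarrow>
      conformal S x y (move_bikes \<beta> v u x)"
    and "turns \<beta> x y u Open Absent \<Longrightarrow> turns \<beta> x y v Bikes Open \<Longrightarrow> turns \<beta> x y w Absent Bikes \<Longrightarrow>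
      conformal S x y (move_E \<beta> u w v x)"
    and "turns \<beta> x y u Bikes Absent \<Longrightarrow> turns \<beta> x y v Open Bikes \<Longrightarrow> turns \<beta> x y w Absent Open \<Longrightarrow>
      conformal S x y (move_O \<beta> u w v x)"
proof -
  note h = hex_between_turns[OF less_imp_le[OF assms], where x = x and y = y]
  note d = turns_distinct[OF assms, where x = x and y = y]
  note defs = conformal_def move_o_def move_e_def move_E_def move_O_def move_bikes_def transfer_units_def
    case_prod_beta fst_conv snd_conv
  show "conformal S x y (move_o \<beta> u v x)"
    if "turns \<beta> x y u Open Absent" "turns \<beta> x y v Absent Open"
    using h(1)[where i = u] h(2)[where i = v] h(7)
      d[where u = u and v = v and p = Open and q = Absent and r = Absent]
      that unfolding defs by simp
  show "conformal S x y (move_e \<beta> u v x)"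
    if "turns \<beta> x y u Bikes Absent" "turns \<beta> x y v Absent Bikes"
    using h(3)[where i = u] h(4)[where i = v] h(7)
      d[where u = u and v = v and p = Bikes and q = Absent and r = Absent]
      that unfolding defs by simp
  show "conformal S x y (move_bikes \<beta> v u x)"
    if "turns \<beta> x y u Open Bikes" "turns \<beta> x y v Bikes Open"
    using h(5)[where i = u] h(6)[where i = v] h(7)
      d[where u = u and v = v and p = Open and q = Bikes and r = Bikes]
      that unfolding defs by simp
  show "conformal S x y (move_E \<beta> u w v x)"
    if "turns \<beta> x y u Open Absent" "turns \<beta> x y v Bikes Open" "turns \<beta> x y w Absent Bikes"
    using h(1)[where i = u] h(6)[where i = v] h(4)[where i = w] h(7)
      d[where u = u and v = v and p = Open and q = Absent and r = Bikes]
      d[where u = v and v = w and p = Bikes and q = Open and r = Absent]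
      d[where u = w and v = u and p = Absent and q = Bikes and r = Open]
      that unfolding defs by simp
  show "conformal S x y (move_O \<beta> u w v x)"
    if "turns \<beta> x y u Bikes Absent" "turns \<beta> x y v Open Bikes" "turns \<beta> x y w Absent Open"
    using h(3)[where i = u] h(5)[where i = v] h(2)[where i = w] h(7)
      d[where u = u and v = v and p = Bikes and q = Absent and r = Open]
      d[where u = v and v = w and p = Open and q = Bikes and r = Absent]
      d[where u = w and v = u and p = Absent and q = Open and r = Bikes]
      that unfolding defs by simp
qed

lemma turns_congruent:
  assumes "congruent S \<alpha> x y" "i \<in> stations S" "0 < \<alpha>"
  shows "turns \<alpha> x y i p q \<longleftrightarrow> amount y p i < amount x p i \<and> amount x q i < amount y q i"
proof -
  have dvd: "\<alpha> dvd amount y r i - amount x r i" for r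
  proof (cases r)
    case Absent
    have "amount y r i - amount x r i = - ((fst y i - fst x i) + (snd y i - snd x i))"
      using Absent by (simp add: docks_def)
    then show ?thesis using assms(1,2) unfolding congruent_def by (metis dvd_add dvd_minus_iff)
  qed (use assms in \<open>auto simp: congruent_def\<close>)
  have "s + \<alpha> \<le> t" if "s < t" "\<alpha> dvd t - s" for s t :: int
    using zdvd_imp_le[OF that(2)] that(1) by simp
  then show ?thesis
    using dvd[of p] dvd[of q] assms(3) unfolding turns_def by (metis dvd_diff_commute less_add_same_cancel1 order_less_le_trans)
qed

lemma sum_amount:
  assumes "allocation S x" "allocation S y"
  shows "(\<Sum>i\<in>stations S. amount x r i) = (\<Sum>i\<in>stations S. amount y r i)"
  using assms by (cases r) (auto simp: allocation_def docks_def sum.distrib sum_negf sum_subtractf)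

lemma amount_increases_elsewhere:
  assumes "allocation S x" "allocation S y" "i \<in> stations S" "amount y r i < amount x r i"
  obtains j where "j \<in> stations S" "amount x r j < amount y r j"
proof -
  have "\<not> (\<forall>j\<in>stations S. amount y r j \<le> amount x r j)"
    using sum_strict_mono_ex1[of "stations S" "amount y r" "amount x r"]
      sum_amount[OF assms(1,2), of r] assms(3,4) by fastforce
  then show thesis using that by (metis not_le)
qed

lemma ereal_exchange_le:
  fixes a b c d :: ereal
  assumes "a + b \<le> c + d" "c \<le> a" "0 \<le> c" "c < \<infinity>"
  shows "b \<le> d"
proof -
  have "c + b \<le> c + d" using assms(1,2) by (meson add_right_mono order_trans)
  then show ?thesis using assms(3,4) by (cases rule: ereal3_cases[of b c d]) auto
qed

lemma ereal_exchange_less: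
  fixes a b c d :: ereal
  assumes "a + b \<le> c + d" "c < a" "0 \<le> c" "0 \<le> b" "d < \<infinity>"
  shows "b < d"
  using assms by (cases rule: ereal3_cases[of b c d]; cases a) auto

section \<open>The exchange property and local optimality\<close>

text \<open>Station \<open>u\<close> turns some \<open>p\<close> into absent docks. If some station turns absent docks into \<open>p\<close>, this closes a
circuit of length four. Otherwise every station \<open>w\<close> whose capacity grows must gain \<open>q\<close>, and every station \<open>v\<close>
that gains \<open>p\<close> must pay for it with \<open>q\<close>; together these form a circuit of length six.\<close>
lemma circuit_through_dock:
  assumes pos: "0 < \<alpha>"
    and alloc: "allocation S x" "allocation S y"
    and cong: "congruent S \<alpha> x y"
    and u: "u \<in> stations S" "docks y u < docks x u"
  obtains p w where "p \<noteq> Absent" "turns \<alpha> x y u p Absent"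
      "w \<in> stations S" "turns \<alpha> x y w Absent p"
    | p q v w where "p \<noteq> Absent" "q \<noteq> Absent" "p \<noteq> q" "turns \<alpha> x y u p Absent"
      "v \<in> stations S" "turns \<alpha> x y v q p" "w \<in> stations S" "turns \<alpha> x y w Absent q"
proof -
  note turns = turns_congruent[OF cong _ pos]
  have total: "amount z p i + amount z q i + amount z Absent i = 0"
    if "p \<noteq> q" "p \<noteq> Absent" "q \<noteq> Absent" for p q z i
    using that by (cases p; cases q) (auto simp: docks_def)
  obtain p where p: "p \<noteq> Absent" "amount y p u < amount x p u"
  proof -
    have "fst y u < fst x u \<or> snd y u < snd x u" using u(2) unfolding docks_def by linarith
    then show thesis using that[of Open] that[of Bikes] by auto
  qed
  obtain q where q: "q \<noteq> Absent" "p \<noteq> q" using p(1) by (cases p) auto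
  have uturn: "turns \<alpha> x y u p Absent" using turns u p by simp
  show thesis
  proof (cases "\<exists>w\<in>stations S. turns \<alpha> x y w Absent p")
    case True
    then show thesis using that(1) p(1) uturn by blast
  next
    case False
    then have direct: "\<not> (amount y Absent w < amount x Absent w \<and> amount x p w < amount y p w)"
      if "w \<in> stations S" for w
      using turns that by blast
    have "amount x Absent u < amount y Absent u" using u by simp
    then obtain w where w: "w \<in> stations S" "amount y Absent w < amount x Absent w"
      using amount_increases_elsewhere[OF alloc(2,1) u(1)] by blast
    obtain v where v: "v \<in> stations S" "amount x p v < amount y p v"
      using amount_increases_elsewhere[OF alloc u(1) p(2)] by blast
    have "amount x q w < amount y q w"
      using total[OF q(2) p(1) q(1), of x w] total[OF q(2) p(1) q(1), of y w] direct[OF w(1)] w(2)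
      by linarith
    moreover have "amount y q v < amount x q v"
      using total[OF q(2) p(1) q(1), of x v] total[OF q(2) p(1) q(1), of y v] direct[OF v(1)] v(2)
      by linarith
    ultimately show thesis
      using that(2)[OF p(1) q uturn v(1) _ w(1)] turns v w by blast
  qed
qed

lemma neighbourhoodI:
  assumes "allocation S z" "i \<in> stations S" "j \<in> stations S" "h \<in> stations S" "i \<noteq> j"
    and "z \<in> {move_o \<alpha> i j x, move_e \<alpha> i j x, move_E \<alpha> i j h x, move_O \<alpha> i j h x}"
  shows "z \<in> neighbourhood S \<alpha> x"
  unfolding neighbourhood_def mem_Collect_eq
  by (rule conjI[OF assms(1)], rule bexI[OF _ assms(2)], rule bexI[OF _ assms(3)],
      rule bexI[OF _ assms(4)], rule conjI[OF assms(5,6)])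

text \<open>This is the exchange axiom of M-convexity for the capacities \<open>d + b\<close>: capacity given up at \<open>u\<close> reappears at a
station \<open>v\<close> where \<open>y\<close> has more of it. It also tells by which dock move this is achieved.\<close>
lemma dock_exchange:
  assumes valid: "valid_system S" and pos: "0 < \<alpha>"
    and alloc: "allocation S x" "allocation S y"
    and cong: "congruent S \<alpha> x y"
    and u: "u \<in> stations S" "docks y u < docks x u"
  obtains z v where "v \<in> stations S" "v \<noteq> u" "docks x v < docks y v" "z \<in> neighbourhood S \<alpha> x"
    "docks z = transfer_units \<alpha> u v (docks x)"
    "cost S z + cost S (reflect x y z) \<le> cost S x + cost S y"
    "distance S x (reflect x y z) < distance S x y"
proof -
  note found = that
  have finish: thesis
    if w: "w \<in> stations S" "turns \<alpha> x y w Absent r" and conf: "conformal S x y z"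
      and z: "z \<in> {move_o \<alpha> u w x, move_e \<alpha> u w x, move_E \<alpha> u w h x, move_O \<alpha> u w h x}"
      and h: "h \<in> stations S" for w r z h
  proof -
    have "docks x w < docks y w" using w(2) pos by (simp add: turns_def)
    moreover from this u have "w \<noteq> u" by auto
    moreover have "docks z = transfer_units \<alpha> u w (docks x)"
      using z by (elim insertE emptyE) (simp_all only: docks_move)
    moreover have "allocation S z"
      using z by (elim insertE emptyE) (simp_all only: allocation_move[OF alloc(1) u(1) w(1) h])
    then have "z \<in> neighbourhood S \<alpha> x"
      by (rule neighbourhoodI[OF _ u(1) w(1) h \<open>w \<noteq> u\<close>[symmetric] z])
    moreover have "docks z u \<noteq> docks x u"
      using \<open>docks z = _\<close> \<open>w \<noteq> u\<close> pos by (simp add: transfer_units_def)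
    then have "0 < distance S x z" using u(1) by (intro distance_pos[of u]) (auto simp: docks_def)
    ultimately show thesis
      using found[of w z] w(1) cost_exchange[OF valid conf] distance_reflect[OF conf] by simp
  qed
  show thesis
  proof (rule circuit_through_dock[OF pos alloc cong u])
    fix p w
    assume p: "p \<noteq> Absent" and t: "turns \<alpha> x y u p Absent" "turns \<alpha> x y w Absent p"
      and w: "w \<in> stations S"
    show thesis
    proof (cases p)
      case Open
      with t have "conformal S x y (move_o \<alpha> u w x)" using conformal_move(1)[OF pos] by blast
      then show thesis by (rule finish[OF w t(2) _ _ u(1)]) simp
    next
      case Bikes
      with t have "conformal S x y (move_e \<alpha> u w x)" using conformal_move(2)[OF pos] by blast
      then show thesis by (rule finish[OF w t(2) _ _ u(1)]) simp
    qed (use p in simp)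
  next
    fix p q v w
    assume pq: "p \<noteq> Absent" "q \<noteq> Absent" "p \<noteq> q"
      and t: "turns \<alpha> x y u p Absent" "turns \<alpha> x y v q p" "turns \<alpha> x y w Absent q"
      and v: "v \<in> stations S" and w: "w \<in> stations S"
    show thesis
    proof (cases p)
      case Open
      with pq have "q = Bikes" by (cases q) auto
      with t Open have "conformal S x y (move_E \<alpha> u w v x)" using conformal_move(4)[OF pos] by blast
      then show thesis by (rule finish[OF w t(3) _ _ v]) simp
    next
      case Bikes
      with pq have "q = Open" by (cases q) auto
      with t Bikes have "conformal S x y (move_O \<alpha> u w v x)" using conformal_move(5)[OF pos] by blast
      then show thesis by (rule finish[OF w t(3) _ _ v]) simp
    qed (use pq in simp)
  qed
qed

text \<open>The state that the bike step aims for and that the descent steps maintain.\<close>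
definition bike_stable :: "bike_system \<Rightarrow> int \<Rightarrow> config \<Rightarrow> bool" where
  "bike_stable S \<alpha> x \<longleftrightarrow>
     (\<forall>u\<in>stations S. \<forall>v\<in>stations S. u \<noteq> v \<longrightarrow> cost S x \<le> cost S (move_bikes \<alpha> v u x))"

text \<open>During a phase with step size \<open>\<alpha>\<close>, the solution moves within its congruence class modulo \<open>\<alpha>\<close>, so this is the
notion of optimality the phase can attain.\<close>
definition class_optimal :: "bike_system \<Rightarrow> int \<Rightarrow> config \<Rightarrow> config \<Rightarrow> bool" where
  "class_optimal S \<alpha> x y \<longleftrightarrow> allocation S y \<and> congruent S \<alpha> x y \<and>
     (\<forall>z. allocation S z \<and> congruent S \<alpha> x z \<longrightarrow> cost S y \<le> cost S z)"

text \<open>With equal capacities the difference to \<open>z\<close> consists of bike moves only. Exchanging one of them cannot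
decrease the cost at \<open>x\<close>, hence its reversal does not increase the cost at \<open>z\<close> and brings \<open>z\<close> closer to \<open>x\<close>.\<close>
lemma bike_stable_optimal:
  assumes valid: "valid_system S" and pos: "0 < \<alpha>"
    and x: "allocation S x" "bike_stable S \<alpha> x" "cost S x < \<infinity>"
    and z: "allocation S z" "congruent S \<alpha> x z" "\<And>i. i \<in> stations S \<Longrightarrow> docks z i = docks x i"
  shows "cost S x \<le> cost S z"
  using z
proof (induction "nat (distance S x z)" arbitrary: z rule: less_induct)
  case less
  note alloc = x(1) less.prems(1)
  show ?case
  proof (cases "\<forall>i\<in>stations S. fst z i = fst x i")
    case True
    then have "\<And>i. i \<in> stations S \<Longrightarrow> fst x i = fst z i \<and> snd x i = snd z i"
      using less.prems(3) unfolding docks_def by force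
    then show ?thesis by (simp only: cost_cong[of S x z] order_refl)
  next
    case False
    have "\<exists>u\<in>stations S. amount z Open u < amount x Open u"
    proof -
      from False obtain i where i: "i \<in> stations S" "fst z i \<noteq> fst x i" by blast
      show ?thesis
      proof (cases "fst z i < fst x i")
        case False
        with i have "amount x Open i < amount z Open i" by simp
        then show ?thesis using amount_increases_elsewhere[OF alloc(2,1) i(1)] by blast
      qed (use i in auto)
    qed
    then obtain u where u: "u \<in> stations S" "amount z Open u < amount x Open u" by blast
    obtain v where v: "v \<in> stations S" "amount x Open v < amount z Open v"
      using amount_increases_elsewhere[OF alloc u] by blast
    have "amount x Bikes u < amount z Bikes u" "amount z Bikes v < amount x Bikes v"
      using less.prems(3)[OF u(1)] less.prems(3)[OF v(1)] u(2) v(2) by (simp_all add: docks_def)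
    then have turns: "turns \<alpha> x z u Open Bikes" "turns \<alpha> x z v Bikes Open"
      using turns_congruent[OF less.prems(2) _ pos] u v by blast+
    define m where "m = move_bikes \<alpha> v u x"
    define r where "r = reflect x z m"
    have conf: "conformal S x z m" unfolding m_def by (rule conformal_move(3)[OF pos turns])
    have "u \<noteq> v" using u v by auto
    then have "fst m u \<noteq> fst x u"
      using pos by (auto simp: m_def move_bikes_def transfer_units_def split: prod.split)
    then have "distance S x r < distance S x z"
      using distance_reflect[OF conf] distance_pos[OF u(1), of m x] by (simp add: r_def)
    moreover have "allocation S r" "congruent S \<alpha> x r"
      unfolding r_def m_def using alloc u(1) v(1) less.prems(2)
      by (auto intro!: allocation_reflect congruent_reflect allocation_move congruent_move)
    moreover have "docks r i = docks x i" if "i \<in> stations S" for i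
      using less.prems(3)[OF that] by (simp add: r_def m_def docks_move)
    ultimately have "cost S x \<le> cost S r"
      using less.hyps[of r] distance_nonneg[of S x r] by auto
    also have "\<dots> \<le> cost S z"
    proof (rule ereal_exchange_le[OF _ _ cost_nonneg x(3)])
      show "cost S m + cost S r \<le> cost S x + cost S z"
        unfolding r_def by (rule cost_exchange[OF valid conf])
      show "cost S x \<le> cost S m"
        using x(2) u(1) v(1) \<open>u \<noteq> v\<close> unfolding bike_stable_def m_def by blast
    qed
    finally show ?thesis .
  qed
qed

text \<open>The same approach of \<open>y\<close> towards \<open>x\<close>, now by dock moves until the capacities agree.\<close>
lemma locally_optimal_class_optimal:
  assumes valid: "valid_system S" and pos: "0 < \<alpha>"
    and x: "allocation S x" "bike_stable S \<alpha> x" "cost S x < \<infinity>"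
    and local: "\<And>z. z \<in> neighbourhood S \<alpha> x \<Longrightarrow> cost S x \<le> cost S z"
  shows "class_optimal S \<alpha> x x"
proof -
  have "cost S x \<le> cost S y" if "allocation S y" "congruent S \<alpha> x y" for y
    using that
  proof (induction "nat (distance S x y)" arbitrary: y rule: less_induct)
    case less
    note y = less.prems
    show ?case
    proof (cases "\<forall>i\<in>stations S. docks y i = docks x i")
      case True
      then show ?thesis using bike_stable_optimal[OF valid pos x y] by blast
    next
      case False
      have "\<exists>u\<in>stations S. docks y u < docks x u"
      proof -
        from False obtain i where i: "i \<in> stations S" "docks y i \<noteq> docks x i" by blast
        show ?thesis
        proof (cases "docks y i < docks x i")
          case False
          with i have "amount y Absent i < amount x Absent i" by simp
          then obtain j where "j \<in> stations S" "amount x Absent j < amount y Absent j"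
            using amount_increases_elsewhere[OF x(1) y(1) i(1)] by blast
          then show ?thesis by auto
        qed (use i in auto)
      qed
      then obtain u where u: "u \<in> stations S" "docks y u < docks x u" by blast
      obtain z where z: "z \<in> neighbourhood S \<alpha> x"
          "cost S z + cost S (reflect x y z) \<le> cost S x + cost S y"
          "distance S x (reflect x y z) < distance S x y"
        by (rule dock_exchange[OF valid pos x(1) y u])
      have "allocation S (reflect x y z)" "congruent S \<alpha> x (reflect x y z)"
        using neighbourhood_cases[OF z(1)] x(1) y
        by (metis allocation_reflect, metis congruent_reflect)
      then have "cost S x \<le> cost S (reflect x y z)"
        using less.hyps[of "reflect x y z"] z(3) distance_nonneg[of S x "reflect x y z"] by auto
      also have "\<dots> \<le> cost S y"
        by (rule ereal_exchange_le[OF z(2) local[OF z(1)] cost_nonneg x(3)])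
      finally show ?thesis .
    qed
  qed
  then show ?thesis using x(1) by (simp add: class_optimal_def congruent_refl)
qed

section \<open>Existence of optima\<close>

lemma finite_cost_bounds:
  assumes "allocation S x" "cost S x < \<infinity>" "i \<in> stations S"
  shows "0 \<le> fst x i" "0 \<le> snd x i" "fst x i + snd x i \<le> int (total_open S + total_bikes S)"
proof -
  have nonneg: "0 \<le> fst x j \<and> 0 \<le> snd x j" if "j \<in> stations S" for j
  proof -
    have "station_cost S j (fst x j) (snd x j) \<noteq> \<infinity>"
      using assms(2) that by (auto simp: cost_def sum_Pinfty simp del: One_nat_def)
    then show ?thesis by (auto simp: station_cost_def split: if_splits)
  qed
  then show "0 \<le> fst x i" "0 \<le> snd x i" using assms(3) by blast+
  have "fst x i + snd x i \<le> (\<Sum>j\<in>stations S. fst x j + snd x j)"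
    using nonneg assms(3) by (intro member_le_sum) auto
  then show "fst x i + snd x i \<le> int (total_open S + total_bikes S)"
    using assms(1) by (simp add: allocation_def)
qed

text \<open>That there are finitely many such values gives the existence of optima, and it makes strictly decreasing
sequences of costs end.\<close>
definition finite_costs :: "bike_system \<Rightarrow> ereal set" where
  "finite_costs S = {cost S z | z. allocation S z \<and> cost S z < \<infinity>}"

lemma finite_finite_costs: "finite (finite_costs S)"
proof -
  define N where "N = int (total_open S + total_bikes S)"
  have "finite_costs S \<subseteq> (\<lambda>g. cost S (\<lambda>i. fst (g i), \<lambda>i. snd (g i))) ` (stations S \<rightarrow>\<^sub>E {0..N} \<times> {0..N})"
  proof
    fix r assume "r \<in> finite_costs S"
    then obtain z where z: "r = cost S z" "allocation S z" "cost S z < \<infinity>"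
      by (auto simp: finite_costs_def)
    define g where "g = (\<lambda>i\<in>stations S. (fst z i, snd z i))"
    have "cost S (\<lambda>i. fst (g i), \<lambda>i. snd (g i)) = r"
      unfolding z(1) by (rule cost_cong) (simp add: g_def)
    moreover have "fst z i \<le> N \<and> snd z i \<le> N" if "i \<in> stations S" for i
      using finite_cost_bounds[OF z(2,3) that] unfolding N_def by linarith
    then have "g \<in> stations S \<rightarrow>\<^sub>E {0..N} \<times> {0..N}"
      unfolding g_def using finite_cost_bounds(1,2)[OF z(2,3)] by (intro restrict_PiE_iff[THEN iffD2]) simp
    ultimately show "r \<in> (\<lambda>g. cost S (\<lambda>i. fst (g i), \<lambda>i. snd (g i))) ` (stations S \<rightarrow>\<^sub>E {0..N} \<times> {0..N})"
      by blast
  qed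
  then show ?thesis by (rule finite_subset) (intro finite_imageI finite_PiE; simp)
qed

lemma class_optimal_exists:
  assumes "allocation S x" "cost S x < \<infinity>"
  obtains y where "class_optimal S \<alpha> x y"
proof -
  define A where "A = {cost S z | z. allocation S z \<and> congruent S \<alpha> x z \<and> cost S z < \<infinity>}"
  have "finite A" by (rule finite_subset[OF _ finite_finite_costs[of S]]) (auto simp: A_def finite_costs_def)
  moreover have "cost S x \<in> A" using assms congruent_refl unfolding A_def by blast
  ultimately have Min: "Min A \<in> A" "\<And>r. r \<in> A \<Longrightarrow> Min A \<le> r" by (auto intro: Min_in)
  then obtain y where y: "Min A = cost S y" "allocation S y" "congruent S \<alpha> x y"
    by (auto simp: A_def)
  have "cost S y \<le> cost S z" if "allocation S z" "congruent S \<alpha> x z" for z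
  proof (cases "cost S z < \<infinity>")
    case True
    then have "cost S z \<in> A" unfolding A_def using that by blast
    then show ?thesis using Min(2) y(1) by metis
  qed simp
  then show thesis using that y(2,3) unfolding class_optimal_def by blast
qed

lemma class_optimal_nearest:
  fixes \<mu> :: "config \<Rightarrow> int"
  assumes "class_optimal S \<alpha> x y0" "\<And>y. 0 \<le> \<mu> y"
  shows "\<exists>y. class_optimal S \<alpha> x y \<and> (\<forall>y'. class_optimal S \<alpha> x y' \<longrightarrow> \<mu> y \<le> \<mu> y')"
proof -
  obtain y where "class_optimal S \<alpha> x y" "\<forall>y'. class_optimal S \<alpha> x y' \<longrightarrow> nat (\<mu> y) \<le> nat (\<mu> y')"
    using ex_has_least_nat[of "class_optimal S \<alpha> x" y0 "\<lambda>y. nat (\<mu> y)"] assms(1) by blast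
  then show ?thesis using assms(2) by (metis eq_nat_nat_iff nat_le_eq_zle order_le_less)
qed

lemma class_optimalI:
  assumes "class_optimal S \<alpha> x y" "allocation S z" "congruent S \<alpha> x z" "cost S z \<le> cost S y"
  shows "class_optimal S \<alpha> x z"
  using assms unfolding class_optimal_def by (meson order_trans)

lemma class_optimal_congruent:
  "congruent S \<alpha> x x' \<Longrightarrow> class_optimal S \<alpha> x y \<longleftrightarrow> class_optimal S \<alpha> x' y"
  unfolding class_optimal_def using congruent_sym congruent_trans by blast

section \<open>Proximity of optima for successive step sizes\<close>

lemma resource_all: "(\<forall>r. P r) \<longleftrightarrow> P Open \<and> P Bikes \<and> P Absent"
  by (metis resource.exhaust)

lemma resource_ex: "(\<exists>r. P r) \<longleftrightarrow> P Open \<or> P Bikes \<or> P Absent"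
  by (metis resource.exhaust)

text \<open>Read \<open>e p q\<close> as an arc on the three resources. There is no cycle of length two or three, so some resource is
a source and another one is a sink.\<close>
lemma acyclic_resources:
  fixes e :: "resource \<Rightarrow> resource \<Rightarrow> bool"
  assumes "\<And>p q. e p q \<Longrightarrow> \<not> e q p"
    and "\<not> (e Open Absent \<and> e Bikes Open \<and> e Absent Bikes)"
    and "\<not> (e Bikes Absent \<and> e Open Bikes \<and> e Absent Open)"
  obtains s t where "s \<noteq> t" "\<And>p. p \<noteq> s \<Longrightarrow> \<not> e p s" "\<And>q. q \<noteq> t \<Longrightarrow> \<not> e t q"
proof -
  have "\<exists>s t. s \<noteq> t \<and> (\<forall>p. p \<noteq> s \<longrightarrow> \<not> e p s) \<and> (\<forall>q. q \<noteq> t \<longrightarrow> \<not> e t q)"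
    using assms(1)[of Open Bikes] assms(1)[of Open Absent] assms(1)[of Bikes Absent] assms(2,3)
    unfolding resource_all resource_ex by simp blast
  then show thesis using that by blast
qed

text \<open>Numbers that sum to zero have as much positive as negative part, so a one-sided bound suffices.\<close>
lemma bounded_above_abs_sum:
  fixes f :: "nat \<Rightarrow> int"
  assumes "sum f A = 0" "\<And>i. i \<in> A \<Longrightarrow> f i \<le> c" "0 \<le> c"
  shows "(\<Sum>i\<in>A. \<bar>f i\<bar>) \<le> 2 * c * int (card A)"
proof -
  have "(\<Sum>i\<in>A. \<bar>f i\<bar>) \<le> (\<Sum>i\<in>A. 2 * c - f i)"
    using assms by (intro sum_mono) force
  also have "\<dots> = 2 * c * int (card A)" using assms(1) by (simp add: sum_subtractf)
  finally show ?thesis .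
qed

text \<open>Take the optimum \<open>y\<close> for step size \<open>\<alpha>\<close> that is nearest to \<open>x\<close>. No move of size \<open>2 \<alpha>\<close> is conformal from \<open>x\<close>
to \<open>y\<close>: it would not improve \<open>x\<close>, so its reversal would keep \<open>y\<close> optimal and bring it closer. Hence the arcs \<open>p \<rightarrow> q\<close> for
which some station turns \<open>2 \<alpha>\<close> units of \<open>p\<close> into \<open>q\<close> form no cycle. The amount of a source resource \<open>s\<close>
can then increase at a station only by \<open>O(\<alpha>)\<close>, the amount of a sink \<open>t\<close> can decrease only by \<open>O(\<alpha>)\<close>, and as
rows sum to zero both rows of the difference matrix are \<open>O(n \<alpha>)\<close> in total. The third row is minus their sum.\<close>
lemma proximity:
  assumes valid: "valid_system S" and pos: "0 < \<alpha>"
    and x: "allocation S x" "bike_stable S (2 * \<alpha>) x" "cost S x < \<infinity>"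
    and local: "\<And>z. z \<in> neighbourhood S (2 * \<alpha>) x \<Longrightarrow> cost S x \<le> cost S z"
  obtains y where "class_optimal S \<alpha> x y" "dock_distance S x y \<le> 16 * \<alpha> * int (num_stations S)"
proof -
  obtain y0 where "class_optimal S \<alpha> x y0" by (rule class_optimal_exists[OF x(1,3)])
  then obtain y where y: "class_optimal S \<alpha> x y"
    and nearest: "\<And>y'. class_optimal S \<alpha> x y' \<Longrightarrow> distance S x y \<le> distance S x y'"
    using class_optimal_nearest[where \<mu> = "distance S x", OF _ distance_nonneg] by blast
  have alloc: "allocation S y" and cong: "congruent S \<alpha> x y" using y by (auto simp: class_optimal_def)
  have pos2: "0 < 2 * \<alpha>" using pos by simp
  have no_move: False
    if z: "conformal S x y z" "allocation S z" "congruent S (2 * \<alpha>) x z" "cost S x \<le> cost S z"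
      and "i \<in> stations S" "fst z i \<noteq> fst x i \<or> snd z i \<noteq> snd x i" for z i
  proof -
    have "cost S (reflect x y z) \<le> cost S y"
      by (rule ereal_exchange_le[OF cost_exchange[OF valid z(1)] z(4) cost_nonneg x(3)])
    then have "class_optimal S \<alpha> x (reflect x y z)"
      using y allocation_reflect[OF x(1) alloc z(2)]
        congruent_reflect[OF cong congruent_multiple[OF z(3)]]
      by (rule class_optimalI[rotated -1])
    then have "distance S x y \<le> distance S x (reflect x y z)" by (rule nearest)
    then show False using distance_reflect[OF z(1)] distance_pos[OF that(5,6)] by simp
  qed
  have no_neighbour: False if "conformal S x y z" "z \<in> neighbourhood S (2 * \<alpha>) x" for z
    using that(2)
  proof (rule neighbourhood_cases)
    fix i j assume ij: "i \<in> stations S" "i \<noteq> j" "docks z = transfer_units (2 * \<alpha>) i j (docks x)"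
      and z: "allocation S z" "congruent S (2 * \<alpha>) x z"
    have "docks z i \<noteq> docks x i" using ij pos by (simp add: transfer_units_def)
    then have "fst z i \<noteq> fst x i \<or> snd z i \<noteq> snd x i" by (auto simp: docks_def)
    then show False by (rule no_move[OF that(1) z local[OF that(2)] ij(1)])
  qed
  define e where "e p q \<longleftrightarrow> (\<exists>i\<in>stations S. turns (2 * \<alpha>) x y i p q)" for p q
  have open_absent: "\<not> (e Open Absent \<and> e Absent Open)"
  proof
    assume "e Open Absent \<and> e Absent Open"
    then obtain u v where uv: "u \<in> stations S" "v \<in> stations S" and
      t: "turns (2 * \<alpha>) x y u Open Absent" "turns (2 * \<alpha>) x y v Absent Open" by (auto simp: e_def)
    have "move_o (2 * \<alpha>) u v x \<in> neighbourhood S (2 * \<alpha>) x"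
      by (rule neighbourhoodI[OF allocation_move(1)[OF x(1) uv uv(1)] uv uv(1) turns_distinct[OF pos2 t]]) simp
    with conformal_move(1)[OF pos2 t] show False by (rule no_neighbour)
  qed
  have bikes_absent: "\<not> (e Bikes Absent \<and> e Absent Bikes)"
  proof
    assume "e Bikes Absent \<and> e Absent Bikes"
    then obtain u v where uv: "u \<in> stations S" "v \<in> stations S" and
      t: "turns (2 * \<alpha>) x y u Bikes Absent" "turns (2 * \<alpha>) x y v Absent Bikes" by (auto simp: e_def)
    have "move_e (2 * \<alpha>) u v x \<in> neighbourhood S (2 * \<alpha>) x"
      by (rule neighbourhoodI[OF allocation_move(2)[OF x(1) uv uv(1)] uv uv(1) turns_distinct[OF pos2 t]]) simp
    with conformal_move(2)[OF pos2 t] show False by (rule no_neighbour)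
  qed
  have open_bikes: "\<not> (e Open Bikes \<and> e Bikes Open)"
  proof
    assume "e Open Bikes \<and> e Bikes Open"
    then obtain u v where uv: "u \<in> stations S" "v \<in> stations S" and
      t: "turns (2 * \<alpha>) x y u Open Bikes" "turns (2 * \<alpha>) x y v Bikes Open" by (auto simp: e_def)
    have "u \<noteq> v" by (rule turns_distinct[OF pos2 t])
    then have "fst (move_bikes (2 * \<alpha>) v u x) u \<noteq> fst x u"
      using pos by (auto simp: move_bikes_def transfer_units_def split: prod.split)
    moreover have "cost S x \<le> cost S (move_bikes (2 * \<alpha>) v u x)"
      using x(2) uv \<open>u \<noteq> v\<close> unfolding bike_stable_def by blast
    ultimately show False
      using no_move[OF conformal_move(3)[OF pos2 t] allocation_move(5)[OF x(1) uv(2,1,1)] congruent_move(5) _ uv(1)]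
      by blast
  qed
  have triple1: "\<not> (e Open Absent \<and> e Bikes Open \<and> e Absent Bikes)"
  proof
    assume "e Open Absent \<and> e Bikes Open \<and> e Absent Bikes"
    then obtain u v w where uvw: "u \<in> stations S" "v \<in> stations S" "w \<in> stations S" and
      t: "turns (2 * \<alpha>) x y u Open Absent" "turns (2 * \<alpha>) x y v Bikes Open" "turns (2 * \<alpha>) x y w Absent Bikes"
      by (auto simp: e_def)
    have "move_E (2 * \<alpha>) u w v x \<in> neighbourhood S (2 * \<alpha>) x"
      by (rule neighbourhoodI[OF allocation_move(3)[OF x(1) uvw(1,3,2)] uvw(1,3,2)
            turns_distinct[OF pos2 t(3,1), symmetric]]) simp
    with conformal_move(4)[OF pos2 t] show False by (rule no_neighbour)
  qed
  have triple2: "\<not> (e Bikes Absent \<and> e Open Bikes \<and> e Absent Open)"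
  proof
    assume "e Bikes Absent \<and> e Open Bikes \<and> e Absent Open"
    then obtain u v w where uvw: "u \<in> stations S" "v \<in> stations S" "w \<in> stations S" and
      t: "turns (2 * \<alpha>) x y u Bikes Absent" "turns (2 * \<alpha>) x y v Open Bikes" "turns (2 * \<alpha>) x y w Absent Open"
      by (auto simp: e_def)
    have "move_O (2 * \<alpha>) u w v x \<in> neighbourhood S (2 * \<alpha>) x"
      by (rule neighbourhoodI[OF allocation_move(4)[OF x(1) uvw(1,3,2)] uvw(1,3,2)
            turns_distinct[OF pos2 t(3,1), symmetric]]) simp
    with conformal_move(5)[OF pos2 t] show False by (rule no_neighbour)
  qed
  have irrefl: "\<not> e p p" for p using pos unfolding e_def turns_def by auto
  have "\<not> e q p" if "e p q" for p q
    using that open_absent bikes_absent open_bikes irrefl by (cases p; cases q) blast+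
  then obtain s t where st: "s \<noteq> t" and s: "\<And>p. p \<noteq> s \<Longrightarrow> \<not> e p s" and t: "\<And>q. q \<noteq> t \<Longrightarrow> \<not> e t q"
    using acyclic_resources[OF _ triple1 triple2] by metis
  define f where "f r i = amount y r i - amount x r i" for r i
  have f_total: "f Open i + f Bikes i + f Absent i = 0" for i by (simp add: f_def docks_def)
  have two_others: "\<exists>p q. p \<noteq> r \<and> q \<noteq> r \<and> (\<forall>i. f r i + f p i + f q i = 0)" for r
  proof (cases r)
    case Open then show ?thesis using f_total by (intro exI[of _ Bikes] exI[of _ Absent]) simp
  next
    case Bikes then show ?thesis using f_total
      by (intro exI[of _ Open] exI[of _ Absent]) (simp add: add.commute)
  next
    case Absent then show ?thesis using f_total
      by (intro exI[of _ Open] exI[of _ Bikes]) (simp add: add.commute add.left_commute)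
  qed
  \<comment> \<open>A larger increase of \<open>s\<close> forces one of the other two resources to shrink by at least \<open>2 \<alpha>\<close>.\<close>
  have le: "f s i \<le> 4 * \<alpha>" if i: "i \<in> stations S" for i
  proof -
    obtain p q where "p \<noteq> s" "q \<noteq> s" and total: "f s i + f p i + f q i = 0" using two_others by blast
    then have "\<not> turns (2 * \<alpha>) x y i p s" "\<not> turns (2 * \<alpha>) x y i q s" using s i by (auto simp: e_def)
    then show ?thesis using total pos unfolding turns_def f_def by linarith
  qed
  have ge: "- f t i \<le> 4 * \<alpha>" if i: "i \<in> stations S" for i
  proof -
    obtain p q where "p \<noteq> t" "q \<noteq> t" and total: "f t i + f p i + f q i = 0" using two_others by blast
    then have "\<not> turns (2 * \<alpha>) x y i t p" "\<not> turns (2 * \<alpha>) x y i t q" using t i by (auto simp: e_def)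
    then show ?thesis using total pos unfolding turns_def f_def by linarith
  qed
  have sum0: "(\<Sum>i\<in>stations S. f r i) = 0" for r
    using sum_amount[OF x(1) alloc, of r] by (simp add: f_def sum_subtractf)
  have fs: "(\<Sum>i\<in>stations S. \<bar>f s i\<bar>) \<le> 8 * \<alpha> * int (num_stations S)"
    using bounded_above_abs_sum[OF sum0 le] pos by simp
  have "(\<Sum>i\<in>stations S. \<bar>- f t i\<bar>) \<le> 8 * \<alpha> * int (num_stations S)"
    using bounded_above_abs_sum[of "\<lambda>i. - f t i" "stations S" "4 * \<alpha>", OF _ ge] sum0[of t] pos by (simp add: sum_negf)
  then have ft: "(\<Sum>i\<in>stations S. \<bar>f t i\<bar>) \<le> 8 * \<alpha> * int (num_stations S)" by simp
  have "\<bar>f Absent i\<bar> \<le> \<bar>f s i\<bar> + \<bar>f t i\<bar>" for i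
    using f_total[of i] st by (cases s; cases t) auto
  then have "(\<Sum>i\<in>stations S. \<bar>f Absent i\<bar>) \<le> (\<Sum>i\<in>stations S. \<bar>f s i\<bar> + \<bar>f t i\<bar>)"
    by (intro sum_mono)
  also have "\<dots> \<le> 16 * \<alpha> * int (num_stations S)" using fs ft by (simp add: sum.distrib)
  finally have "dock_distance S x y \<le> 16 * \<alpha> * int (num_stations S)"
    by (simp add: dock_distance_def f_def abs_minus_commute)
  with y show thesis by (rule that)
qed

section \<open>Progress of a descent step\<close>

lemma dock_distance_commute: "dock_distance S x y = dock_distance S y x"
  by (simp add: dock_distance_def abs_minus_commute)

lemma dock_distance_transfer:
  assumes "k \<in> stations S" "j \<in> stations S" "k \<noteq> j"
    and "\<And>i. i \<in> stations S \<Longrightarrow> docks y' i = transfer_units \<alpha> k j (docks y) i"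
  shows "dock_distance S x y' = dock_distance S x y
      + (\<bar>docks y k - \<alpha> - docks x k\<bar> - \<bar>docks y k - docks x k\<bar>)
      + (\<bar>docks y j + \<alpha> - docks x j\<bar> - \<bar>docks y j - docks x j\<bar>)"
proof -
  have "dock_distance S x y' = (\<Sum>i\<in>stations S. \<bar>docks y i - docks x i\<bar>
      + (if i = k then \<bar>docks y k - \<alpha> - docks x k\<bar> - \<bar>docks y k - docks x k\<bar> else 0)
      + (if i = j then \<bar>docks y j + \<alpha> - docks x j\<bar> - \<bar>docks y j - docks x j\<bar> else 0))"
    unfolding dock_distance_def using assms(3,4)
    by (intro sum.cong) (simp_all add: transfer_units_def)
  also have "\<dots> = dock_distance S x y
      + (\<bar>docks y k - \<alpha> - docks x k\<bar> - \<bar>docks y k - docks x k\<bar>)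
      + (\<bar>docks y j + \<alpha> - docks x j\<bar> - \<bar>docks y j - docks x j\<bar>)"
    using assms(1,2) unfolding dock_distance_def sum.distrib by (simp add: sum.delta)
  finally show ?thesis .
qed

lemma congruent_gap:
  assumes "congruent S \<alpha> x y" "i \<in> stations S" "0 < \<alpha>"
  shows "docks x i < docks y i \<Longrightarrow> docks x i + \<alpha> \<le> docks y i"
    and "docks y i < docks x i \<Longrightarrow> docks y i + \<alpha> \<le> docks x i"
proof -
  have "\<alpha> dvd (fst y i - fst x i) + (snd y i - snd x i)"
    using assms(1,2) unfolding congruent_def by (intro dvd_add) blast+
  then have "\<alpha> dvd docks y i - docks x i" by (simp add: docks_def algebra_simps)
  then obtain k where "docks y i - docks x i = \<alpha> * k" by (rule dvdE)
  then have k: "docks y i = docks x i + \<alpha> * k" by simp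
  show "docks x i + \<alpha> \<le> docks y i" if "docks x i < docks y i"
  proof -
    have "0 < k" using that assms(3) k by (simp add: zero_less_mult_iff)
    then show ?thesis using assms(3) k by simp
  qed
  show "docks y i + \<alpha> \<le> docks x i" if "docks y i < docks x i"
  proof -
    have "k < 0" using that assms(3) k by (simp add: mult_less_0_iff)
    then have "\<alpha> * k \<le> \<alpha> * (- 1)" using assms(3) by (intro mult_left_mono) auto
    then show ?thesis using k by simp
  qed
qed

text \<open>For a bike-stable \<open>x\<close>, the neighbourhood contains a best way to transfer capacity \<open>\<alpha>\<close> between two given
stations, among all ways to arrange the bikes: exchanging towards \<open>z\<close> yields a neighbour with the same
capacities as \<open>z\<close>, and the mirror image has the capacities of \<open>x\<close>, so it is no cheaper than \<open>x\<close>.\<close>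
lemma descent_step_best_transfer:
  assumes valid: "valid_system S" and pos: "0 < \<alpha>"
    and x: "allocation S x" "bike_stable S \<alpha> x" "cost S x < \<infinity>"
    and best: "\<forall>z\<in>neighbourhood S \<alpha> x. cost S x' \<le> cost S z"
    and z: "allocation S z" "congruent S \<alpha> x z"
    and ab: "a \<in> stations S" "b \<in> stations S" "a \<noteq> b"
    and docks: "\<And>i. i \<in> stations S \<Longrightarrow> docks z i = transfer_units \<alpha> a b (docks x) i"
  shows "cost S x' \<le> cost S z"
proof -
  have "docks z a < docks x a" using docks[OF ab(1)] ab(3) pos by (simp add: transfer_units_def)
  then obtain w v where v: "v \<in> stations S" "v \<noteq> a" "docks x v < docks z v"
    and w: "w \<in> neighbourhood S \<alpha> x" "docks w = transfer_units \<alpha> a v (docks x)"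
      "cost S w + cost S (reflect x z w) \<le> cost S x + cost S z"
    by (rule dock_exchange[OF valid pos x(1) z ab(1)])
  have "v = b" using docks[OF v(1)] v(2,3) by (auto simp: transfer_units_def split: if_splits)
  have "docks (reflect x z w) i = docks x i" if "i \<in> stations S" for i
    using docks[OF that] w(2) \<open>v = b\<close> by simp
  moreover from w(1) have "allocation S (reflect x z w) \<and> congruent S \<alpha> x (reflect x z w)"
    by (rule neighbourhood_cases) (simp add: allocation_reflect congruent_reflect x(1) z)
  ultimately have "cost S x \<le> cost S (reflect x z w)"
    using bike_stable_optimal[OF valid pos x] by blast
  then have "cost S w \<le> cost S z"
    by (rule ereal_exchange_le[OF w(3)[unfolded add.commute[of "cost S w"]] _ cost_nonneg x(3)])
  with w(1) best show ?thesis by (meson order_trans)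
qed

text \<open>Stability under bike moves is inherited because a bike move after the step is still a transfer of capacity
from \<open>i\<close> to \<open>j\<close>, and \<open>x'\<close> is a best one. For the distance, it suffices to find a nearest optimum with more
capacity than \<open>x\<close> at \<open>j\<close> and less at \<open>i\<close>. An optimum violating one of these is exchanged with \<open>x'\<close> at the offending
station. On the side of \<open>x'\<close> this produces another transfer from or to the same station, no better than \<open>x'\<close>;
so the other side remains optimal, is no further from \<open>x\<close>, and has the desired sign.\<close>
lemma descent_step:
  assumes valid: "valid_system S" and pos: "0 < \<alpha>"
    and x: "allocation S x" "bike_stable S \<alpha> x" "cost S x < \<infinity>"
    and x': "x' \<in> neighbourhood S \<alpha> x" "cost S x' < cost S x"
    and best: "\<forall>z\<in>neighbourhood S \<alpha> x. cost S x' \<le> cost S z"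
    and opt: "class_optimal S \<alpha> x y0"
  shows "bike_stable S \<alpha> x'"
    and "\<exists>y. class_optimal S \<alpha> x' y \<and> dock_distance S x' y + 2 * \<alpha> \<le> dock_distance S x y0"
proof -
  obtain i j where ij: "i \<in> stations S" "j \<in> stations S" "i \<noteq> j"
    and alloc': "allocation S x'" and cong': "congruent S \<alpha> x x'"
    and docks': "docks x' = transfer_units \<alpha> i j (docks x)"
    by (rule neighbourhood_cases[OF x'(1)])
  note best_transfer = descent_step_best_transfer[OF valid pos x best]
  have fin': "cost S x' < \<infinity>" using x'(2) x(3) by (rule less_trans)
  show "bike_stable S \<alpha> x'"
    unfolding bike_stable_def
  proof (intro ballI impI)
    fix u v assume uv: "u \<in> stations S" "v \<in> stations S"
    show "cost S x' \<le> cost S (move_bikes \<alpha> v u x')"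
      by (rule best_transfer[OF allocation_move(5)[OF alloc' uv(2,1,1)]
            congruent_trans[OF cong' congruent_move(5)] ij]) (simp add: docks_move docks')
  qed
  define near where "near y \<longleftrightarrow> class_optimal S \<alpha> x y \<and>
     (\<forall>y'. class_optimal S \<alpha> x y' \<longrightarrow> dock_distance S x y \<le> dock_distance S x y')" for y
  have near: "allocation S y" "congruent S \<alpha> x y" "congruent S \<alpha> x' y" "cost S y < \<infinity>" if "near y" for y
  proof -
    show a: "allocation S y" "congruent S \<alpha> x y" using that by (auto simp: near_def class_optimal_def)
    show "congruent S \<alpha> x' y" by (rule congruent_trans[OF congruent_sym[OF cong'] a(2)])
    have "cost S y \<le> cost S x"
      using that x(1) congruent_refl unfolding near_def class_optimal_def by blast
    then show "cost S y < \<infinity>" using x(3) by (rule order_le_less_trans)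
  qed
  have "\<exists>y. near y \<and> docks x j < docks y j"
  proof -
    obtain y where "near y"
      using class_optimal_nearest[where \<mu> = "dock_distance S x", OF opt dock_distance_nonneg]
      unfolding near_def by metis
    show ?thesis
    proof (cases "docks x j < docks y j")
      case True
      with \<open>near y\<close> show ?thesis by blast
    next
      case False
      then have "docks y j < docks x' j" using docks' ij pos by (simp add: transfer_units_def)
      then obtain z k where k: "k \<in> stations S" "k \<noteq> j" "docks x' k < docks y k"
        and z: "z \<in> neighbourhood S \<alpha> x'" "docks z = transfer_units \<alpha> j k (docks x')"
          "cost S z + cost S (reflect x' y z) \<le> cost S x' + cost S y"
        by (rule dock_exchange[OF valid pos alloc' near(1,3)[OF \<open>near y\<close>] ij(2)])
      define r where "r = reflect x' y z"
      from z(1) have z': "allocation S z" "congruent S \<alpha> x' z" by (auto elim: neighbourhood_cases)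
      have r: "allocation S r" "congruent S \<alpha> x r"
        unfolding r_def using allocation_reflect[OF alloc' near(1)[OF \<open>near y\<close>] z'(1)]
          congruent_trans[OF cong' congruent_reflect[OF near(3)[OF \<open>near y\<close>] z'(2)]] by blast+
      have xz: "congruent S \<alpha> x z" by (rule congruent_trans[OF cong' z'(2)])
      have docks_r: "docks r m = transfer_units \<alpha> k j (docks y) m" for m
        unfolding r_def docks_reflect z(2) by (simp add: transfer_units_def)
      \<comment> \<open>For \<open>k = i\<close> the exchange would undo the step, which strictly increases the cost at \<open>x'\<close>.\<close>
      have "k \<noteq> i"
      proof
        assume "k = i"
        then have "cost S x \<le> cost S z"
          using bike_stable_optimal[OF valid pos x z'(1) xz] ij(3)
          unfolding z(2) docks' by (simp add: transfer_units_def)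
        with x'(2) have "cost S x' < cost S z" by (rule order_less_le_trans)
        then have "cost S r < cost S y"
          using ereal_exchange_less[OF z(3) _ cost_nonneg cost_nonneg near(4)[OF \<open>near y\<close>]]
          by (simp add: r_def)
        then show False
          using r \<open>near y\<close> unfolding near_def class_optimal_def by (meson not_le)
      qed
      have "cost S x' \<le> cost S z"
        by (rule best_transfer[OF z'(1) xz ij(1) k(1) \<open>k \<noteq> i\<close>[symmetric]])
          (use ij(3) in \<open>simp add: z(2) docks' transfer_units_def\<close>)
      then have "cost S r \<le> cost S y"
        unfolding r_def by (rule ereal_exchange_le[OF z(3) _ cost_nonneg fin'])
      then have r_opt: "class_optimal S \<alpha> x r"
        using class_optimalI[OF _ r] \<open>near y\<close> unfolding near_def by blast
      have dist_r: "dock_distance S x r = dock_distance S x y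
          + (\<bar>docks y k - \<alpha> - docks x k\<bar> - \<bar>docks y k - docks x k\<bar>)
          + (\<bar>docks y j + \<alpha> - docks x j\<bar> - \<bar>docks y j - docks x j\<bar>)"
        by (rule dock_distance_transfer[OF k(1) ij(2) k(2) docks_r])
      have "docks x k < docks y k"
        using k(2,3) \<open>k \<noteq> i\<close> by (simp add: docks' transfer_units_def)
      then have gap_k: "docks x k + \<alpha> \<le> docks y k"
        by (rule congruent_gap(1)[OF near(2)[OF \<open>near y\<close>] k(1) pos])
      have "dock_distance S x y \<le> dock_distance S x r"
        using r_opt \<open>near y\<close> unfolding near_def by blast
      moreover have "docks y j + \<alpha> \<le> docks x j" if "docks y j \<noteq> docks x j"
        using congruent_gap(2)[OF near(2)[OF \<open>near y\<close>] ij(2) pos] that False by linarith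
      \<comment> \<open>Otherwise \<open>r\<close> would be closer than \<open>y\<close> by \<open>2 \<alpha>\<close>.\<close>
      ultimately have eq_j: "docks y j = docks x j" using dist_r gap_k pos by linarith
      then have "dock_distance S x r = dock_distance S x y" using dist_r gap_k pos by simp
      then have "near r" using r_opt \<open>near y\<close> unfolding near_def by simp
      moreover have "docks x j < docks r j"
        using docks_r[of j] k(2) eq_j pos by (simp add: transfer_units_def)
      ultimately show ?thesis by blast
    qed
  qed
  then obtain y1 where y1: "near y1" "docks x j < docks y1 j" by blast
  have "\<exists>y. near y \<and> docks x j < docks y j \<and> docks y i < docks x i"
  proof (cases "docks y1 i < docks x i")
    case True
    with y1 show ?thesis by blast
  next
    case False
    note y = near[OF y1(1)]
    from False have "docks x' i < docks y1 i" using docks' ij pos by (simp add: transfer_units_def)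
    then obtain z k where k: "k \<in> stations S" "k \<noteq> i" "docks y1 k < docks x' k"
      and z: "z \<in> neighbourhood S \<alpha> y1" "docks z = transfer_units \<alpha> i k (docks y1)"
        "cost S z + cost S (reflect y1 x' z) \<le> cost S y1 + cost S x'"
      by (rule dock_exchange[OF valid pos y(1) alloc' congruent_sym[OF y(3)] ij(1)])
    define r where "r = reflect y1 x' z"
    from z(1) have z': "allocation S z" "congruent S \<alpha> y1 z" by (auto elim: neighbourhood_cases)
    have xz: "congruent S \<alpha> x z" by (rule congruent_trans[OF y(2) z'(2)])
    have r: "allocation S r" "congruent S \<alpha> x r"
      unfolding r_def using allocation_reflect[OF y(1) alloc' z'(1)]
        congruent_trans[OF y(2) congruent_reflect[OF congruent_sym[OF y(3)] z'(2)]] by blast+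
    have docks_r: "docks r m = transfer_units \<alpha> k i (docks x') m" for m
      unfolding r_def docks_reflect z(2) by (simp add: transfer_units_def)
    have "docks x' j \<le> docks y1 j"
      using congruent_gap(1)[OF y(2) ij(2) pos y1(2)] ij(3) by (simp add: docks' transfer_units_def)
    then have "k \<noteq> j" using k(3) by auto
    have "cost S x' \<le> cost S r"
      by (rule best_transfer[OF r k(1) ij(2) \<open>k \<noteq> j\<close>])
        (use ij(3) in \<open>simp add: docks_r docks' transfer_units_def\<close>)
    then have "cost S z \<le> cost S y1"
      unfolding r_def
      by (rule ereal_exchange_le[OF z(3)[unfolded add.commute[of "cost S z"] add.commute[of "cost S y1"]]
            _ cost_nonneg fin'])
    then have z_opt: "class_optimal S \<alpha> x z"
      using class_optimalI[OF _ z'(1) xz] y1(1) unfolding near_def by blast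
    have dist_z: "dock_distance S x z = dock_distance S x y1
        + (\<bar>docks y1 i - \<alpha> - docks x i\<bar> - \<bar>docks y1 i - docks x i\<bar>)
        + (\<bar>docks y1 k + \<alpha> - docks x k\<bar> - \<bar>docks y1 k - docks x k\<bar>)"
      by (rule dock_distance_transfer[OF ij(1) k(1) k(2)[symmetric]]) (simp add: z(2))
    have "docks y1 k < docks x k"
      using k(2,3) \<open>k \<noteq> j\<close> by (simp add: docks' transfer_units_def)
    then have gap_k: "docks y1 k + \<alpha> \<le> docks x k"
      by (rule congruent_gap(2)[OF y(2) k(1) pos])
    have "dock_distance S x y1 \<le> dock_distance S x z"
      using z_opt y1(1) unfolding near_def by blast
    moreover have "docks x i + \<alpha> \<le> docks y1 i" if "docks y1 i \<noteq> docks x i"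
      using congruent_gap(1)[OF y(2) ij(1) pos] that False by linarith
    ultimately have eq_i: "docks y1 i = docks x i" using dist_z gap_k pos by linarith
    then have "dock_distance S x z = dock_distance S x y1" using dist_z gap_k pos by simp
    then have "near z" using z_opt y1(1) unfolding near_def by simp
    moreover have "docks z i < docks x i" "docks x j < docks z j"
      using k(2) \<open>k \<noteq> j\<close> ij(3) eq_i y1(2) pos by (simp_all add: z(2) transfer_units_def)
    ultimately show ?thesis by blast
  qed
  then obtain y where y: "near y" "docks x j < docks y j" "docks y i < docks x i" by blast
  have "dock_distance S x' y = dock_distance S x y - 2 * \<alpha>"
    using dock_distance_transfer[OF ij, of x' \<alpha> x y]
      congruent_gap(1)[OF near(2)[OF y(1)] ij(2) pos y(2)]
      congruent_gap(2)[OF near(2)[OF y(1)] ij(1) pos y(3)] pos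
    unfolding dock_distance_commute[of S y] docks' by simp
  moreover have "dock_distance S x y \<le> dock_distance S x y0"
    using y(1) opt unfolding near_def by blast
  moreover have "class_optimal S \<alpha> x' y"
    using y(1) class_optimal_congruent[OF cong'] unfolding near_def by blast
  ultimately show "\<exists>y. class_optimal S \<alpha> x' y \<and> dock_distance S x' y + 2 * \<alpha> \<le> dock_distance S x y0"
    by (intro exI[of _ y]) simp
qed

section \<open>The bike step\<close>

lemma cost_move_bikes:
  assumes "u \<in> stations S" "v \<in> stations S" "u \<noteq> v"
  obtains R where "0 \<le> R"
    "cost S x = station_cost S u (fst x u) (snd x u) + station_cost S v (fst x v) (snd x v) + R"
    "cost S (move_bikes \<alpha> v u x) = station_cost S u (fst x u - \<alpha>) (snd x u + \<alpha>) +
        station_cost S v (fst x v + \<alpha>) (snd x v - \<alpha>) + R"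
proof -
  define R where "R = (\<Sum>i\<in>stations S - {u} - {v}. station_cost S i (fst x i) (snd x i))"
  have split: "cost S z = station_cost S u (fst z u) (snd z u) + station_cost S v (fst z v) (snd z v) +
      (\<Sum>i\<in>stations S - {u} - {v}. station_cost S i (fst z i) (snd z i))" for z
    unfolding cost_def using assms
    by (simp add: sum.remove[of "stations S" u] sum.remove[of "stations S - {u}" v] add.assoc del: One_nat_def)
  have rest: "(\<Sum>i\<in>stations S - {u} - {v}.
      station_cost S i (fst (move_bikes \<alpha> v u x) i) (snd (move_bikes \<alpha> v u x) i)) = R"
    unfolding R_def by (rule sum.cong) (auto simp: move_bikes_def transfer_units_def split: prod.split)
  have ends: "fst (move_bikes \<alpha> v u x) u = fst x u - \<alpha>" "snd (move_bikes \<alpha> v u x) u = snd x u + \<alpha>"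
    "fst (move_bikes \<alpha> v u x) v = fst x v + \<alpha>" "snd (move_bikes \<alpha> v u x) v = snd x v - \<alpha>"
    using assms(3) by (auto simp: move_bikes_def transfer_units_def split: prod.split)
  have "0 \<le> R" unfolding R_def by (intro sum_nonneg station_cost_nonneg)
  then show thesis
    by (rule that[OF _ split[of x, folded R_def] split[of "move_bikes \<alpha> v u x", unfolded rest ends]])
qed

text \<open>For \<open>i = j\<close> the test would ask for strict concavity along the direction \<open>(1, -1)\<close>. This excludes moves that
change nothing, with which the bike step would never end.\<close>
lemma bike_improves_distinct:
  assumes "valid_system S" "i \<in> stations S" "0 < \<alpha>" "bike_improves S \<alpha> x i j"
  shows "i \<noteq> j"
proof
  assume "i = j"
  have hex: "hex_between (fst x i - \<alpha>) (snd x i + \<alpha>) (fst x i + \<alpha>) (snd x i - \<alpha>) (fst x i) (snd x i)"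
    using assms(3) by (simp add: hex_between_def between_def)
  have "fst x i - \<alpha> + (fst x i + \<alpha>) - fst x i = fst x i" "snd x i + \<alpha> + (snd x i - \<alpha>) - snd x i = snd x i"
    by simp_all
  then have "\<not> bike_improves S \<alpha> x i i"
    using station_cost_exchange[OF assms(1,2) hex] unfolding bike_improves_def by (simp only: not_less)
  with assms(4) \<open>i = j\<close> show False by simp
qed

lemma bike_improves_iff:
  assumes "i \<in> stations S" "j \<in> stations S" "i \<noteq> j" "cost S x < \<infinity>"
  shows "bike_improves S \<alpha> x i j \<longleftrightarrow> cost S (move_bikes \<alpha> j i x) < cost S x"
proof -
  obtain R where R: "0 \<le> R"
    "cost S x = station_cost S i (fst x i) (snd x i) + station_cost S j (fst x j) (snd x j) + R"
    "cost S (move_bikes \<alpha> j i x) = station_cost S i (fst x i - \<alpha>) (snd x i + \<alpha>) +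
        station_cost S j (fst x j + \<alpha>) (snd x j - \<alpha>) + R"
    by (rule cost_move_bikes[OF assms(1-3)])
  have "R < \<infinity>" using assms(4) R(1,2) by (metis ereal_infty_less(1) ereal_plus_eq_PInfty)
  then obtain r where "R = ereal r" using R(1) by (cases R) auto
  then have "a + R < b + R \<longleftrightarrow> a < b" for a b :: ereal
    by (cases rule: ereal2_cases[of a b]) auto
  then show ?thesis unfolding R(2,3) bike_improves_def by simp
qed

text \<open>The cost change of a bike move is the sum of one gain at either end, so maximizing both separately tests all pairs
at once.\<close>
lemma no_improvement_bike_stable:
  assumes fin: "cost S x < \<infinity>" and choice: "bike_choice S \<alpha> x i j"
    and no: "\<not> bike_improves S \<alpha> x i j"
  shows "bike_stable S \<alpha> x"
  unfolding bike_stable_def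
proof (intro ballI impI)
  fix u v assume uv: "u \<in> stations S" "v \<in> stations S" "u \<noteq> v"
  have i: "i \<in> stations S" and j: "j \<in> stations S"
    using choice by (simp_all only: bike_choice_def is_arg_max_def)
  have gains: "gain_receive S \<alpha> x u \<le> gain_receive S \<alpha> x i" "gain_give S \<alpha> x v \<le> gain_give S \<alpha> x j"
    using choice uv unfolding bike_choice_def is_arg_max_def by (meson not_le)+
  have real: "\<exists>r. station_cost S m (fst x m) (snd x m) = ereal r" if "m \<in> stations S" for m
  proof -
    have "station_cost S m (fst x m) (snd x m) \<noteq> \<infinity>"
      using fin that by (auto simp: cost_def sum_Pinfty simp del: One_nat_def)
    then show ?thesis
      using station_cost_nonneg[of S m "fst x m" "snd x m"]
      by (cases "station_cost S m (fst x m) (snd x m)") auto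
  qed
  obtain cu cv ci cj where c: "station_cost S u (fst x u) (snd x u) = ereal cu"
      "station_cost S v (fst x v) (snd x v) = ereal cv"
      "station_cost S i (fst x i) (snd x i) = ereal ci"
      "station_cost S j (fst x j) (snd x j) = ereal cj"
    using real uv i j by metis
  have compare: "ereal a + ereal b \<le> a' + b'"
    if "ereal a - a' \<le> ereal c - c'" "ereal b - b' \<le> ereal d - d'" "ereal c + ereal d \<le> c' + d'"
      "0 \<le> a'" "0 \<le> b'" "0 \<le> c'" "0 \<le> d'" for a b c d a' b' c' d'
    using that by (cases a'; cases b'; cases c'; cases d') auto
  have "\<not> bike_improves S \<alpha> x u v"
    using compare[OF gains[unfolded gain_receive_def gain_give_def c] _
        station_cost_nonneg station_cost_nonneg station_cost_nonneg station_cost_nonneg] no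
    unfolding bike_improves_def c by (simp only: not_less)
  then show "cost S x \<le> cost S (move_bikes \<alpha> v u x)"
    using bike_improves_iff[OF uv fin] by (simp only: not_less)
qed

section \<open>The invariant of the algorithm\<close>

lemma step_size_pos: "0 < step_size S k"
  by (simp add: step_size_def)

lemma step_size_Suc:
  assumes "k < last_phase S"
  shows "step_size S k = 2 * step_size S (Suc k)"
proof -
  have "last_phase S - k = Suc (last_phase S - Suc k)" using assms by simp
  then show ?thesis by (simp add: step_size_def)
qed

lemma step_size_last: "step_size S (last_phase S) = 1"
  by (simp add: step_size_def)

lemma step_size_0_large:
  assumes "valid_system S"
  shows "int (total_open S + total_bikes S) < step_size S 0"
proof -
  define N where "N = total_bikes S + total_open S"
  have "1 \<le> real N" using assms by (simp add: valid_system_def N_def)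
  then have "0 \<le> log 2 (real N)" by simp
  then have "log 2 (real N) < real (last_phase S)"
    unfolding last_phase_def N_def[symmetric] by linarith
  then have "real N < 2 powr real (last_phase S)"
    using \<open>1 \<le> real N\<close> by (simp add: log_less_iff)
  also have "\<dots> = real_of_int (step_size S 0)" by (simp add: powr_realpow step_size_def)
  finally show ?thesis unfolding N_def by linarith
qed

text \<open>The potential argument for the count \<open>q\<close> of iterations over all phases up to \<open>k\<close>: a descent step trades dock
distance \<open>2 \<alpha>\<close> for one iteration, and each phase adds a dock distance of at most \<open>16 n \<alpha>\<close>. Measuring both
in units of the current \<open>\<alpha>\<close> keeps the earlier iterations on the account.\<close>
definition within_budget :: "bike_system \<Rightarrow> nat \<Rightarrow> nat \<Rightarrow> config \<Rightarrow> bool" where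
  "within_budget S k q x \<longleftrightarrow> (\<exists>y. class_optimal S (step_size S k) x y \<and>
     dock_distance S x y + 2 * step_size S k * int q \<le>
       16 * step_size S k * int (num_stations S) * int (Suc k))"

lemma within_budget_count:
  assumes "within_budget S k q x"
  shows "q \<le> 8 * num_stations S * Suc k"
proof -
  have "2 * step_size S k * int q \<le> 2 * step_size S k * int (8 * num_stations S * Suc k)"
    using assms dock_distance_nonneg[of S x] unfolding within_budget_def
    by (auto simp: algebra_simps intro: order_trans[rotated])
  then show ?thesis using step_size_pos[of S k] by (simp only: mult_le_cancel_left_pos of_nat_le_iff)
qed

text \<open>The initial step size exceeds \<open>B + D\<close>, so all finite-cost allocations in a congruence class coincide.\<close>
lemma within_budget_initial:
  assumes valid: "valid_system S" and x: "allocation S x" "cost S x < \<infinity>"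
  shows "within_budget S 0 0 x"
proof -
  let ?\<alpha> = "step_size S 0"
  have small: "s = t" if "?\<alpha> dvd s - t" "0 \<le> s" "0 \<le> t" "s < ?\<alpha>" "t < ?\<alpha>" for s t
    using zdvd_imp_le[OF that(1)] zdvd_imp_le[of ?\<alpha> "t - s"] that
    by (cases s t rule: linorder_cases) (auto simp: dvd_diff_commute)
  have "cost S x \<le> cost S z" if z: "allocation S z" "congruent S ?\<alpha> x z" for z
  proof (cases "cost S z < \<infinity>")
    case True
    have "fst x i = fst z i \<and> snd x i = snd z i" if "i \<in> stations S" for i
      using finite_cost_bounds[OF x that] finite_cost_bounds[OF z(1) True that]
        step_size_0_large[OF valid] z(2) that small[of "fst z i" "fst x i"] small[of "snd z i" "snd x i"]
      unfolding congruent_def by force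
    then show ?thesis by (simp only: cost_cong[of S x z] order_refl)
  qed simp
  then have "class_optimal S ?\<alpha> x x" using x(1) congruent_refl by (simp add: class_optimal_def)
  then show ?thesis
    unfolding within_budget_def using step_size_pos[of S 0]
    by (intro exI[of _ x]) (simp add: dock_distance_def)
qed

fun invariant :: "bike_system \<Rightarrow> nat \<Rightarrow> alg_state \<Rightarrow> bool" where
  "invariant S q (Bike k x) \<longleftrightarrow>
     k \<le> last_phase S \<and> allocation S x \<and> cost S x < \<infinity> \<and> within_budget S k q x"
| "invariant S q (Descent k x) \<longleftrightarrow>
     k \<le> last_phase S \<and> allocation S x \<and> cost S x < \<infinity> \<and> within_budget S k q x \<and>
     bike_stable S (step_size S k) x"
| "invariant S q (Finished x) \<longleftrightarrow> optimal S x \<and> q \<le> 8 * num_stations S * Suc (last_phase S)"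

lemma bike_move_decreases:
  assumes "valid_system S" "cost S x < \<infinity>" "0 < \<alpha>"
    and "bike_choice S \<alpha> x i j" "bike_improves S \<alpha> x i j"
  shows "i \<in> stations S" "j \<in> stations S" "cost S (move_bikes \<alpha> j i x) < cost S x"
proof -
  show ij: "i \<in> stations S" "j \<in> stations S"
    using assms(4) by (simp_all only: bike_choice_def is_arg_max_def)
  show "cost S (move_bikes \<alpha> j i x) < cost S x"
    using bike_improves_iff[OF ij _ assms(2)] bike_improves_distinct[OF assms(1) ij(1) assms(3,5)] assms(5)
    by blast
qed

text \<open>At the end of a phase the solution is locally optimal under dock moves, by the stopping rule, and under bike moves, by
the invariant. This gives optimality in the last phase, where the step size is one, and otherwise allows
\<open>proximity\<close> to open the account of the next phase.\<close>
lemma invariant_step: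
  assumes valid: "valid_system S" and "invariant S q s" "alg_step S s r s'"
  shows "invariant S (q + r) s'"
  using assms(3,2)
proof cases
  case (bike_move k x i j)
  let ?\<alpha> = "step_size S k"
  have x: "k \<le> last_phase S" "allocation S x" "cost S x < \<infinity>" "within_budget S k q x"
    using assms(2) bike_move by auto
  note move = bike_move_decreases[OF valid x(3) step_size_pos bike_move(4,5)]
  have "allocation S (move_bikes ?\<alpha> j i x)" by (rule allocation_move(5)[OF x(2) move(2,1,1)])
  moreover have "cost S (move_bikes ?\<alpha> j i x) < \<infinity>" using move(3) x(3) by (rule less_trans)
  moreover have "within_budget S k q (move_bikes ?\<alpha> j i x)"
    using x(4) unfolding within_budget_def dock_distance_def docks_move
      class_optimal_congruent[OF congruent_move(5)[of S ?\<alpha> x j i]] .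
  ultimately show ?thesis using bike_move x(1) by simp
next
  case (bike_end k x i j)
  then show ?thesis using assms(2) no_improvement_bike_stable by auto
next
  case (descent_move k x y)
  let ?\<alpha> = "step_size S k"
  have x: "k \<le> last_phase S" "allocation S x" "cost S x < \<infinity>" "bike_stable S ?\<alpha> x"
    using assms(2) descent_move by auto
  obtain z where z: "class_optimal S ?\<alpha> x z" and budget: "dock_distance S x z + 2 * ?\<alpha> * int q \<le>
       16 * ?\<alpha> * int (num_stations S) * int (Suc k)"
    using assms(2) descent_move by (auto simp: within_budget_def)
  have y: "y \<in> neighbourhood S ?\<alpha> x" "\<forall>z\<in>neighbourhood S ?\<alpha> x. cost S y \<le> cost S z"
    using descent_move(4) unfolding is_arg_min_linorder by blast+
  note step = descent_step[OF valid step_size_pos x(2,4,3) y(1) descent_move(5) y(2) z]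
  obtain z' where "class_optimal S ?\<alpha> y z'" "dock_distance S y z' + 2 * ?\<alpha> \<le> dock_distance S x z"
    using step(2) by blast
  then have "within_budget S k (q + 1) y"
    unfolding within_budget_def using budget by (intro exI[of _ z']) (simp add: algebra_simps)
  moreover have "allocation S y" using y(1) by (simp add: neighbourhood_def)
  moreover have "cost S y < \<infinity>" using descent_move(5) x(3) by (rule less_trans)
  ultimately show ?thesis using descent_move x(1) step(1) by simp
next
  case (descent_end k x)
  let ?\<alpha> = "step_size S k"
  have x: "k \<le> last_phase S" "allocation S x" "cost S x < \<infinity>" "bike_stable S ?\<alpha> x"
      "within_budget S k q x"
    using assms(2) descent_end by auto
  have local: "cost S x \<le> cost S z" if "z \<in> neighbourhood S ?\<alpha> x" for z
    using descent_end(4) that by (meson not_le)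
  note count = within_budget_count[OF x(5)]
  show ?thesis
  proof (cases "k < last_phase S")
    case True
    let ?\<beta> = "step_size S (Suc k)"
    note double = step_size_Suc[OF True]
    obtain y where y: "class_optimal S ?\<beta> x y" "dock_distance S x y \<le> 16 * ?\<beta> * int (num_stations S)"
      by (rule proximity[OF valid step_size_pos[of S "Suc k"] x(2) _ x(3)])
        (use x(4) local in \<open>auto simp: double\<close>)
    have "2 * ?\<beta> * int q \<le> 2 * ?\<beta> * int (8 * num_stations S * Suc k)"
      using count step_size_pos[of S "Suc k"] by (simp only: mult_le_cancel_left_pos of_nat_le_iff)
    with y have "within_budget S (Suc k) q x"
      unfolding within_budget_def by (intro exI[of _ y]) (simp add: algebra_simps)
    then show ?thesis using descent_end x True by simp
  next
    case False
    then have k: "k = last_phase S" using x(1) by simp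
    have "class_optimal S 1 x x"
      using locally_optimal_class_optimal[OF valid step_size_pos x(2,4,3) local]
      unfolding k step_size_last .
    then have "optimal S x"
      unfolding optimal_def is_arg_min_linorder class_optimal_def congruent_def by simp
    then show ?thesis using descent_end False count k by simp
  qed
qed

lemma invariant_run:
  assumes "valid_system S" "allocation S x" "cost S x < \<infinity>" "alg_run S (Bike 0 x) q s"
  shows "invariant S q s"
  using assms(4)
proof (induction "Bike 0 x" q s rule: alg_run.induct)
  case refl
  then show ?case using within_budget_initial assms by simp
next
  case (step q s' r s'')
  then show ?case using invariant_step[OF assms(1)] by blast
qed

section \<open>Termination\<close>

definition costs_below :: "bike_system \<Rightarrow> config \<Rightarrow> nat" where
  "costs_below S x = card {c \<in> finite_costs S. c < cost S x}"

lemma costs_below_less: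
  assumes "allocation S y" "cost S y < cost S x"
  shows "costs_below S y < costs_below S x"
  unfolding costs_below_def
proof (rule psubset_card_mono)
  have "cost S y \<in> finite_costs S"
    using assms order_less_le_trans[OF assms(2) ereal_less_eq(1)] unfolding finite_costs_def by blast
  then show "{c \<in> finite_costs S. c < cost S y} \<subset> {c \<in> finite_costs S. c < cost S x}"
    using assms(2) by (auto intro: less_trans)
qed (simp add: finite_finite_costs)

text \<open>A transition either decreases the cost, which can take finitely many finite values, or leaves the
solution alone and moves on to the next of the two parts of each phase.\<close>
fun rank :: "bike_system \<Rightarrow> alg_state \<Rightarrow> nat" where
  "rank S (Bike k x) = 2 * (last_phase S - k) + 2 + costs_below S x"
| "rank S (Descent k x) = 2 * (last_phase S - k) + 1 + costs_below S x"
| "rank S (Finished x) = 0"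

lemma rank_step:
  assumes valid: "valid_system S" and inv: "invariant S q s" and step: "alg_step S s r s'"
  shows "rank S s' < rank S s"
  using step
proof cases
  case (bike_move k x i j)
  have x: "allocation S x" "cost S x < \<infinity>" using inv bike_move by auto
  note move = bike_move_decreases[OF valid x(2) step_size_pos bike_move(4,5)]
  show ?thesis
    using bike_move costs_below_less[OF allocation_move(5)[OF x(1) move(2,1,1)] move(3)] by simp
next
  case (bike_end k x i j)
  then show ?thesis by simp
next
  case (descent_move k x y)
  then have "allocation S y" by (simp add: is_arg_min_def neighbourhood_def)
  then show ?thesis using descent_move costs_below_less by simp
next
  case (descent_end k x)
  show ?thesis
  proof (cases "k < last_phase S")
    case True
    then have "last_phase S - k = Suc (last_phase S - Suc k)" by simp
    then show ?thesis using descent_end True by simp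
  qed (use descent_end in simp)
qed

lemma progress:
  assumes valid: "valid_system S" and inv: "invariant S q s" and "\<nexists>r s'. alg_step S s r s'"
  obtains y where "s = Finished y"
proof (cases s)
  case (Bike k x)
  have "stations S \<noteq> {}"
  proof
    assume empty: "stations S = {}"
    have "int (total_open S + total_bikes S) = (\<Sum>i\<in>stations S. fst x i + snd x i)"
      using inv Bike by (simp only: invariant.simps allocation_def)
    also have "\<dots> = 0" unfolding empty by simp
    finally show False using valid by (simp add: valid_system_def)
  qed
  have arg_max: "\<exists>i. is_arg_max g (\<lambda>m. m \<in> stations S) i" for g :: "nat \<Rightarrow> ereal"
  proof -
    have "Max (g ` stations S) \<in> g ` stations S"
      using \<open>stations S \<noteq> {}\<close> by (intro Max_in finite_imageI finite_atLeastAtMost) blast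
    then obtain i where i: "i \<in> stations S" "Max (g ` stations S) = g i" by (elim imageE)
    have "g m \<le> g i" if "m \<in> stations S" for m
      unfolding i(2)[symmetric] using that
      by (intro Max_ge finite_imageI finite_atLeastAtMost imageI)
    then have "is_arg_max g (\<lambda>m. m \<in> stations S) i"
      unfolding is_arg_max_linorder using i(1) by simp
    then show ?thesis ..
  qed
  obtain i j where "bike_choice S (step_size S k) x i j"
    unfolding bike_choice_def
    using arg_max[of "gain_receive S (step_size S k) x"] arg_max[of "gain_give S (step_size S k) x"]
    by (elim exE) simp
  then show thesis using assms(3) Bike alg_step.bike_move alg_step.bike_end by blast
next
  case (Descent k x)
  define A where "A = neighbourhood S (step_size S k) x"
  have "A \<subseteq> (\<Union>i\<in>stations S. \<Union>j\<in>stations S. \<Union>h\<in>stations S.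
     {move_o (step_size S k) i j x, move_e (step_size S k) i j x,
      move_E (step_size S k) i j h x, move_O (step_size S k) i j h x})"
    unfolding A_def neighbourhood_def by blast
  then have "finite A" by (rule finite_subset) simp
  have "\<exists>r s'. alg_step S (Descent k x) r s'"
  proof (cases "\<exists>y\<in>A. cost S y < cost S x")
    case True
    then obtain y where y: "y \<in> A" "cost S y < cost S x" by blast
    have "Min (cost S ` A) \<in> cost S ` A" using \<open>finite A\<close> y(1) by (intro Min_in) auto
    then obtain z where z: "z \<in> A" "cost S z = Min (cost S ` A)" by auto
    then have "is_arg_min (cost S) (\<lambda>z. z \<in> A) z"
      using \<open>finite A\<close> by (simp add: is_arg_min_linorder)
    moreover have "cost S z < cost S x"
      using y z(2) \<open>finite A\<close> by (metis Min_le finite_imageI imageI order_le_less_trans)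
    ultimately show ?thesis unfolding A_def using alg_step.descent_move by blast
  next
    case False
    then show ?thesis unfolding A_def using alg_step.descent_end by blast
  qed
  then show thesis using assms(3) Descent by blast
qed (rule that)

lemma algorithm_terminates:
  assumes valid: "valid_system S" and x: "allocation S x" "cost S x < \<infinity>"
  shows "terminates_from S (Bike 0 x)"
  unfolding terminates_from_def
proof
  assume "\<exists>f :: nat \<Rightarrow> alg_state. f 0 = Bike 0 x \<and> (\<forall>m. \<exists>r. alg_step S (f m) r (f (Suc m)))"
  then obtain f where f: "f 0 = Bike 0 x" "\<And>m. \<exists>r. alg_step S (f m) r (f (Suc m))" by blast
  have inv: "\<exists>q. invariant S q (f m)" for m
  proof (induction m)
    case 0
    show ?case using within_budget_initial[OF valid x] x f(1) by (intro exI[of _ 0]) simp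
  next
    case (Suc m)
    then show ?case using f(2) invariant_step[OF valid] by blast
  qed
  have "rank S (f m) + m \<le> rank S (f 0)" for m
  proof (induction m)
    case (Suc m)
    have "rank S (f (Suc m)) < rank S (f m)" using inv[of m] f(2)[of m] rank_step[OF valid] by blast
    then show ?case using Suc by simp
  qed simp
  from this[of "Suc (rank S (f 0))"] show False by simp
qed

section \<open>Optimality and the number of iterations\<close>

lemma phases_le_log:
  assumes "2 \<le> total_bikes S + total_open S"
  shows "real (Suc (last_phase S)) \<le> 3 * log 2 (real (total_bikes S + total_open S))"
proof -
  have "1 \<le> log 2 (real (total_bikes S + total_open S))"
    using assms by (subst le_log_iff) auto
  then show ?thesis unfolding last_phase_def by linarith
qed

theorem theorem2:
  "\<exists>C :: real. \<forall>(S :: bike_system) (x :: config).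
     valid_system S \<and> allocation S x \<and> cost S x < \<infinity> \<longrightarrow>
       terminates_from S (Bike 0 x) \<and>
       (\<forall>q s. alg_run S (Bike 0 x) q s \<and> \<not> (\<exists>r s'. alg_step S s r s') \<longrightarrow>
          (\<exists>y. s = Finished y \<and> optimal S y)) \<and>
       (total_bikes S + total_open S \<ge> 2 \<longrightarrow>
          (\<forall>q s. alg_run S (Bike 0 x) q s \<longrightarrow>
             real q \<le> C * real (num_stations S) * log 2 (real (total_bikes S + total_open S))))"
\<comment> \<open>At most \<open>8 n\<close> iterations in each of at most \<open>3 log (B + D)\<close> phases.\<close>
proof (intro exI[of _ 24] allI impI conjI; elim conjE)
  fix S x assume S: "valid_system S" "allocation S x" "cost S x < \<infinity>"
  note inv = invariant_run[OF S]
  show "terminates_from S (Bike 0 x)" by (rule algorithm_terminates[OF S])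
  show "\<exists>y. s = Finished y \<and> optimal S y"
    if run: "alg_run S (Bike 0 x) q s" and stuck: "\<nexists>r s'. alg_step S s r s'" for q s
  proof -
    obtain y where s: "s = Finished y" by (rule progress[OF S(1) inv[OF run] stuck])
    show ?thesis by (rule exI[of _ y]) (use inv[OF run] s in simp)
  qed
  show "real q \<le> 24 * real (num_stations S) * log 2 (real (total_bikes S + total_open S))"
    if N: "2 \<le> total_bikes S + total_open S" and run: "alg_run S (Bike 0 x) q s" for q s
  proof -
    have "q \<le> 8 * num_stations S * Suc (last_phase S)"
    proof (cases s)
      case (Finished y)
      then show ?thesis using inv[OF run] by simp
    next
      case (Bike k y)
      have "q \<le> 8 * num_stations S * Suc k" "k \<le> last_phase S"
        using inv[OF run] within_budget_count[of S k q y] unfolding Bike invariant.simps by blast+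
      then show ?thesis by (meson Suc_le_mono mult_le_mono2 order_trans)
    next
      case (Descent k y)
      have "q \<le> 8 * num_stations S * Suc k" "k \<le> last_phase S"
        using inv[OF run] within_budget_count[of S k q y] unfolding Descent invariant.simps by blast+
      then show ?thesis by (meson Suc_le_mono mult_le_mono2 order_trans)
    qed
    then have "real q \<le> real (8 * num_stations S) * real (Suc (last_phase S))"
      by (metis of_nat_le_iff of_nat_mult)
    also have "\<dots> \<le> real (8 * num_stations S) * (3 * log 2 (real (total_bikes S + total_open S)))"
      by (intro mult_left_mono phases_le_log N) simp
    finally show ?thesis by (simp add: mult_ac)
  qed
qed

end
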